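(* Let $f\in X$ and let $r$ be a positive integer. For $n=0,1,2,\dots$ put $$R_n=\widetilde{\omega}_{2}\left(f,\frac{\pi}{n+1}\right)_{X}+\sum_{\mu=1}^{n}\frac{\widetilde{\omega}_{2}\left(f,\frac{\pi}{\mu}\right)_{X}}{\mu}\sum_{k=0}^{\mu+1}a_{n,k}+\sum_{\mu=1}^{n}\widetilde{\omega}_{2}\left(f,\frac{\pi}{\mu}\right)_{X}\sum_{k=\mu}^{\infty}\left|a_{n,k}-a_{n,k+r}\right|.$$ (i) If $$\int_{0}^{u}t^{-1}\widetilde{\omega}_{2}(f,t)_{X}\,dt=O\left(\widetilde{\omega}_{2}(f,u)_{X}\right)\qquad\text{for }u\in[0,2\pi],$$ then $$\left\|\widetilde{T}_{n,A}f(\cdot)-\widetilde{f}(\cdot)\right\|_{X}=O(R_n),\qquad n=0,1,2,\dots.$$ (ii) If the matrix $A$ is such that $$\sum_{k=0}^{\infty}(k+1)a_{n,k}=O(n+1),$$ then $$\left\|\widetilde{T}_{n,A}f(\cdot)-\widetilde{f}\left(\cdot,\frac{\pi}{r(n+1)}\right)\right\|_{X}=O(R_n),\qquad n=0,1,2,\dots.$$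
   Context: $X$ denotes either $L^{p}$ ($1\le p\le\infty$), the space of $2\pi$-periodic real-valued functions that are Lebesgue integrable with $p$-th power over $Q=[-\pi,\pi]$ (essentially bounded if $p=\infty$), with norm $\|f\|_{L^p}=(\int_Q|f(t)|^p\,dt)^{1/p}$ for $p<\infty$ and $\|f\|_{L^\infty}=\operatorname{ess\,sup}_{t\in Q}|f(t)|$; or $C$, the space of continuous $2\pi$-periodic real-valued functions with the sup norm. For $f\in X$ with real Fourier coefficients $a_\nu(f)=\frac1\pi\int_{-\pi}^{\pi}f(t)\cos\nu t\,dt$, $b_\nu(f)=\frac1\pi\int_{-\pi}^{\pi}f(t)\sin\nu t\,dt$, the partial sums of the conjugate Fourier series are $\widetilde S_kf(x)=\sum_{\nu=1}^{k}(a_\nu(f)\sin\nu x-b_\nu(f)\cos\nu x)$ (so $\widetilde S_0f=0$). Put $\psi_x(t)=f(x+t)-f(x-t)$, and for $\epsilon>0$ $$\widetilde f(x,\epsilon)=-\frac1\pi\int_\epsilon^\pi\psi_x(t)\,\frac12\cot\frac t2\,dt,\qquad \widetilde f(x)=\lim_{\epsilon\to0^+}\widetilde f(x,\epsilon),$$ the latter existing for almost all $x$. $A=(a_{n,k})_{n,k\ge0}$ is an infinite matrix of real numbers with $a_{n,k}\ge0$ for all $n,k$, $\lim_{n\to\infty}a_{n,k}=0$ for each $k$, and $\sum_{k=0}^\infty a_{n,k}=1$ for each $n$. Further $\widetilde T_{n,A}f(x)=\sum_{k=0}^\infty a_{n,k}\widetilde S_kf(x)$, $n=0,1,2,\dots$.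 The second conjugate modulus of continuity is $\widetilde\omega_2(f,\delta)_X=\sup_{0<t\le\delta}\|\psi_\cdot(t)\|_X$ (equal to $0$ for $\delta=0$). All $O$-relations are uniform over the indicated range of the variable ($u$ or $n=0,1,2,\dots$): the implied constants do not depend on $u$, $n$ (they may depend on $f,r,A$). Empty sums are $0$. *)

theory Defs
  imports "HOL-Analysis.Analysis" "HOL-Probability.Essential_Supremum"
begin

abbreviation Q :: "real set" where
  "Q \<equiv> {-pi..pi}"

text \<open>The spaces \<open>X\<close>: \<open>Lp p\<close> (meaningful for real \<open>p \<ge> 1\<close>), \<open>Linf\<close>, and the continuous functions
  \<open>Cont\<close>.  Elements of the Lebesgue spaces are everywhere defined, everywhere \<open>2\<pi>\<close>-periodic
  representatives.\<close>

datatype fun_space = Lp real | Linf | Cont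

fun in_space :: "fun_space \<Rightarrow> (real \<Rightarrow> real) \<Rightarrow> bool" where
  "in_space (Lp p) f \<longleftrightarrow> (\<forall>x. f (x + 2 * pi) = f x) \<and>
     f \<in> borel_measurable (lebesgue_on Q) \<and> integrable (lebesgue_on Q) (\<lambda>t. \<bar>f t\<bar> powr p)"
| "in_space Linf f \<longleftrightarrow> (\<forall>x. f (x + 2 * pi) = f x) \<and>
     f \<in> borel_measurable (lebesgue_on Q) \<and> esssup (lebesgue_on Q) (\<lambda>t. ereal \<bar>f t\<bar>) < \<infinity>"
| "in_space Cont f \<longleftrightarrow> (\<forall>x. f (x + 2 * pi) = f x) \<and> continuous_on UNIV f"

text \<open>Only meaningful on elements of the space: outside it, the value is arbitrary, so a bound on
  \<open>norm_space X g\<close> has to be accompanied by \<open>in_space X g\<close>.\<close>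

fun norm_space :: "fun_space \<Rightarrow> (real \<Rightarrow> real) \<Rightarrow> real" where
  "norm_space (Lp p) f = (LINT t|lebesgue_on Q. \<bar>f t\<bar> powr p) powr (1 / p)"
| "norm_space Linf f = real_of_ereal (esssup (lebesgue_on Q) (\<lambda>t. ereal \<bar>f t\<bar>))"
| "norm_space Cont f = (SUP t. \<bar>f t\<bar>)"

text \<open>Pointwise statements about elements of the space: almost everywhere for the Lebesgue spaces,
  everywhere for continuous functions.\<close>

fun pointwise_in :: "fun_space \<Rightarrow> (real \<Rightarrow> bool) \<Rightarrow> bool" where
  "pointwise_in (Lp p) P \<longleftrightarrow> (AE x in lebesgue. P x)"
| "pointwise_in Linf P \<longleftrightarrow> (AE x in lebesgue. P x)"
| "pointwise_in Cont P \<longleftrightarrow> (\<forall>x. P x)"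

definition fourier_cos :: "(real \<Rightarrow> real) \<Rightarrow> nat \<Rightarrow> real" where
  "fourier_cos f \<nu> = 1 / pi * (LINT t|lebesgue_on Q. f t * cos (real \<nu> * t))"

definition fourier_sin :: "(real \<Rightarrow> real) \<Rightarrow> nat \<Rightarrow> real" where
  "fourier_sin f \<nu> = 1 / pi * (LINT t|lebesgue_on Q. f t * sin (real \<nu> * t))"

definition conj_partial_sum :: "nat \<Rightarrow> (real \<Rightarrow> real) \<Rightarrow> real \<Rightarrow> real" where
  "conj_partial_sum k f x =
     (\<Sum>\<nu> = 1..k. fourier_cos f \<nu> * sin (real \<nu> * x) - fourier_sin f \<nu> * cos (real \<nu> * x))"

definition psi :: "(real \<Rightarrow> real) \<Rightarrow> real \<Rightarrow> real \<Rightarrow> real" where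
  "psi f x t = f (x + t) - f (x - t)"

definition conj_trunc :: "(real \<Rightarrow> real) \<Rightarrow> real \<Rightarrow> real \<Rightarrow> real" where
  "conj_trunc f x \<epsilon> =
     - (1 / pi) * (LINT t:{\<epsilon>..pi}|lebesgue. psi f x t * (1 / 2 * cot (t / 2)))"

definition conj_fun :: "(real \<Rightarrow> real) \<Rightarrow> real \<Rightarrow> real" where
  "conj_fun f x = Lim (at_right 0) (\<lambda>\<epsilon>. conj_trunc f x \<epsilon>)"

definition conj_fun_exists :: "(real \<Rightarrow> real) \<Rightarrow> real \<Rightarrow> bool" where
  "conj_fun_exists f x \<longleftrightarrow> (\<exists>l. ((\<lambda>\<epsilon>. conj_trunc f x \<epsilon>) \<longlongrightarrow> l) (at_right 0))"

definition conj_mean :: "(nat \<Rightarrow> nat \<Rightarrow> real) \<Rightarrow> nat \<Rightarrow> (real \<Rightarrow> real) \<Rightarrow> real \<Rightarrow> real" where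
  "conj_mean A n f x = (\<Sum>k. A n k * conj_partial_sum k f x)"

definition conj_mean_converges ::
    "(nat \<Rightarrow> nat \<Rightarrow> real) \<Rightarrow> nat \<Rightarrow> (real \<Rightarrow> real) \<Rightarrow> real \<Rightarrow> bool" where
  "conj_mean_converges A n f x \<longleftrightarrow> summable (\<lambda>k. A n k * conj_partial_sum k f x)"

definition conj_modulus2 :: "fun_space \<Rightarrow> (real \<Rightarrow> real) \<Rightarrow> real \<Rightarrow> real" where
  "conj_modulus2 X f \<delta> =
     (if \<delta> \<le> 0 then 0 else SUP t\<in>{0<..\<delta>}. norm_space X (\<lambda>x. psi f x t))"

definition rate ::
    "fun_space \<Rightarrow> (real \<Rightarrow> real) \<Rightarrow> (nat \<Rightarrow> nat \<Rightarrow> real) \<Rightarrow> nat \<Rightarrow> nat \<Rightarrow> real" where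
  "rate X f A r n =
     conj_modulus2 X f (pi / (real n + 1))
     + (\<Sum>\<mu> = 1..n. conj_modulus2 X f (pi / real \<mu>) / real \<mu> * (\<Sum>k = 0..\<mu> + 1. A n k))
     + (\<Sum>\<mu> = 1..n. conj_modulus2 X f (pi / real \<mu>)
          * (\<Sum>j. \<bar>A n (\<mu> + j) - A n (\<mu> + j + r)\<bar>))"

end

theory Submission
  imports Defs
begin

text \<open>The deviation is a singular integral of the symmetric differences \<open>\<psi>\<^sub>x(t)\<close>.  Summing the conjugate
  Dirichlet kernels \<open>\<Sum> sin (\<nu>t) = cot (t / 2) / 2 - cos ((k + 1/2) t) / (2 sin (t / 2))\<close> over \<open>\<nu> \<le> k\<close>
  with weights \<open>a k = A n k\<close> of total mass 1, the cotangent cancels against that of the conjugate function,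
  and on the range of the truncated integral there remains the kernel \<open>F(t) / (2\<pi> sin (t / 2))\<close> with
  \<open>F(t) = \<Sum>k. a k * cos ((k + 1/2) t)\<close>.  By Minkowski's integral inequality
  (\<open>bounded_in_integral\<close>) the norm of the deviation is at most the integral of \<open>\<omega>(t)\<close>, the modulus of
  continuity, against the absolute value of the kernel; see \<open>psi_kernel_bound\<close>.

  On \<open>(0, \<pi> / (r(n + 1)))\<close> this integral is \<open>O(\<omega>(\<pi> / (n + 1)))\<close>: in part (i) because \<open>\<bar>F\<bar> \<le> 1\<close> and
  by the assumption on \<open>\<omega>(t) / t\<close>, in part (ii) because the moment condition bounds the mean of the
  conjugate Dirichlet kernels by \<open>O(n)\<close>.

  On the rest of \<open>(0, \<pi>)\<close>, summation by parts with step \<open>r\<close> (\<open>abs_cos_mean_le\<close>) bounds \<open>\<bar>F(t)\<bar>\<close>, for every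
  \<open>m\<close>, by the mass of the first \<open>m\<close> weights plus \<open>\<Sum>k\<ge>m. \<bar>a k - a (k + r)\<bar>\<close> divided by
  \<open>\<bar>sin (r t / 2)\<bar>\<close>.  Choosing \<open>m\<close> of the order of \<open>1 / t\<close> near the origin gives the sums over \<open>\<mu>\<close> in the rate.
  The difficulty is that for \<open>r \<ge> 2\<close> the divisor has further zeros \<open>2\<pi>l / r\<close>, at which \<open>\<omega>\<close> is not small.
  Near them \<open>m\<close> is chosen of the order of the inverse distance to the zero; the factor \<open>1 / t\<close> of the kernel is harmless
  there, and the inequality \<open>\<omega>(\<pi>) \<le> \<mu> \<omega>(\<pi> / \<mu>)\<close> (\<open>modulus_multiple\<close>) makes up exactly for the missing
  smallness of \<open>\<omega>\<close>.  This is \<open>cos_mean_integral_le\<close>.\<close>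

section \<open>Periodic functions and integrals over a period\<close>

abbreviation torus :: "real measure" where
  "torus \<equiv> restrict_space lborel Q"

lemma finite_measure_torus: "finite_measure torus"
  by (rule finite_measureI) (simp add: emeasure_restrict_space space_restrict_space)

lemma sigma_finite_torus: "sigma_finite_measure torus"
  using finite_measure_torus by (simp add: finite_measure.axioms)

lemma AE_torus_iff: "(AE x in torus. P x) \<longleftrightarrow> (AE x in lborel. x \<in> Q \<longrightarrow> P x)"
  by (rule AE_restrict_space_iff) simp

lemma AE_lborel_affine:
  fixes P :: "real \<Rightarrow> bool"
  assumes "AE x in lborel. P x" and "c \<noteq> 0"
  shows "AE x in lborel. P (a + c * x)"
proof -
  obtain N where N: "N \<in> null_sets lborel" "{x. \<not> P x} \<subseteq> N"
    using assms(1) by (auto elim!: AE_E simp: null_sets_def)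
  have [measurable]: "N \<in> sets borel" using N by auto
  have "AE x in lborel. x \<notin> N" using N(1) by (rule AE_not_in)
  then have "AE x in lborel. a + c * x \<notin> N"
    using assms(2) by (intro AE_borel_affine) auto
  then show ?thesis by (rule AE_mp) (use N in auto)
qed

text \<open>The representative of \<open>x\<close> modulo \<open>2\<pi>\<close> in \<open>[-\<pi>, \<pi>)\<close>.  A periodic function factors through \<open>wrap\<close>,
  which turns questions on the line into questions on one period, and which also makes a function
  that is only controlled on one period into a periodic one.\<close>

definition wrap :: "real \<Rightarrow> real" where
  "wrap x = x - 2 * pi * of_int \<lfloor>(x + pi) / (2 * pi)\<rfloor>"

lemma wrap_mem: "wrap x \<in> {-pi..<pi}"
proof -
  define q where "q = \<lfloor>(x + pi) / (2 * pi)\<rfloor>"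
  have "of_int q \<le> (x + pi) / (2 * pi)" "(x + pi) / (2 * pi) < of_int q + 1"
    unfolding q_def by linarith+
  then have "2 * pi * of_int q \<le> x + pi" "x + pi < 2 * pi * (of_int q + 1)"
    by (simp_all add: field_simps)
  then show ?thesis unfolding wrap_def q_def[symmetric] by (simp add: algebra_simps)
qed

lemma wrap_ident: "x \<in> {-pi..<pi} \<Longrightarrow> wrap x = x"
  by (auto simp: wrap_def intro!: floor_unique)

lemma periodic_int:
  fixes h :: "real \<Rightarrow> 'a"
  assumes per: "\<And>x. h (x + 2 * pi) = h x"
  shows "h (x + 2 * pi * of_int i) = h x"
proof -
  have per_nat: "h (x + 2 * pi * real k) = h x" for x k
  proof (induction k)
    case (Suc k)
    then show ?case using per[of "x + 2 * pi * real k"] by (simp add: algebra_simps)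
  qed simp
  show ?thesis
  proof (cases i rule: int_cases2)
    case (nonneg k) then show ?thesis using per_nat by simp
  next
    case (nonpos k) then show ?thesis using per_nat[of "x - 2 * pi * real k" k] by simp
  qed
qed

lemma periodic_wrap:
  fixes h :: "real \<Rightarrow> 'a"
  assumes "\<And>x. h (x + 2 * pi) = h x"
  shows "h (wrap x) = h x"
  using periodic_int[where h = h, OF assms, of x "- \<lfloor>(x + pi) / (2 * pi)\<rfloor>"]
  by (simp add: wrap_def)

lemma wrap_periodic: "wrap (x + 2 * pi) = wrap x"
proof -
  have "(x + 2 * pi + pi) / (2 * pi) = (x + pi) / (2 * pi) + 1" by (simp add: field_simps)
  then show ?thesis unfolding wrap_def by (simp add: algebra_simps)
qed

text \<open>The line is a countable union of translates of one period, so a null set of exceptions in one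
  period gives a null set of exceptions on the line.\<close>

lemma AE_periodic:
  fixes P :: "real \<Rightarrow> bool"
  assumes per: "\<And>x. P (x + 2 * pi) = P x" and Q: "AE x in torus. P x"
  shows "AE x in lborel. P x"
proof -
  have "AE x in lborel. \<forall>i::int. 2 * pi * of_int i + 1 * x \<in> Q \<longrightarrow> P (2 * pi * of_int i + 1 * x)"
    unfolding AE_all_countable
    by (intro allI AE_lborel_affine) (use Q in \<open>auto simp: AE_torus_iff\<close>)
  then show ?thesis
  proof (rule AE_mp, intro AE_I2 impI)
    fix x assume "\<forall>i::int. 2 * pi * of_int i + 1 * x \<in> Q \<longrightarrow> P (2 * pi * of_int i + 1 * x)"
    from spec[OF this, of "- \<lfloor>(x + pi) / (2 * pi)\<rfloor>"] have "P (wrap x)"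
      using wrap_mem[of x] by (simp add: wrap_def)
    then show "P x" using periodic_wrap[where h = P, OF per] by simp
  qed
qed

text \<open>The integral over the window \<open>[a - \<pi>, a + \<pi>)\<close> does not change when the window moves by less
  than a period, since the piece lost on the left is regained on the right; by its own periodicity in
  \<open>a\<close> it is then constant.\<close>

lemma nn_integral_torus_translate:
  fixes h :: "real \<Rightarrow> ennreal"
  assumes [measurable]: "h \<in> borel_measurable borel" and per: "\<And>x. h (x + 2 * pi) = h x"
  shows "(\<integral>\<^sup>+x. h (x + a) \<partial>torus) = (\<integral>\<^sup>+x. h x \<partial>torus)"
proof -
  define I where "I s u = (\<integral>\<^sup>+x\<in>{s..<u}. h x \<partial>lborel)" for s u
  have split: "I s u = I s m + I m u" if "s \<le> m" "m \<le> u" for s m u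
  proof -
    have "I s u = (\<integral>\<^sup>+x. h x * indicator {s..<m} x + h x * indicator {m..<u} x \<partial>lborel)"
      unfolding I_def by (intro nn_integral_cong) (use that in \<open>auto simp: indicator_def\<close>)
    then show ?thesis unfolding I_def by (simp add: nn_integral_add)
  qed
  have shift: "I (s + 2 * pi) (u + 2 * pi) = I s u" for s u
  proof -
    have "I (s + 2 * pi) (u + 2 * pi)
        = (\<integral>\<^sup>+x. h (2 * pi + 1 * x) * indicator {s + 2 * pi..<u + 2 * pi} (2 * pi + 1 * x) \<partial>lborel)"
      unfolding I_def by (subst nn_integral_real_affine[where c = 1 and t = "2 * pi"]) auto
    also have "\<dots> = I s u"
      unfolding I_def using per
      by (intro nn_integral_cong) (auto simp: indicator_def add.commute)
    finally show ?thesis .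
  qed
  have torus: "(\<integral>\<^sup>+x. h (x + a) \<partial>torus) = I (a - pi) (a + pi)" for a
  proof -
    have "(\<integral>\<^sup>+x. h (x + a) \<partial>torus) = (\<integral>\<^sup>+x. h (x + a) * indicator Q x \<partial>lborel)"
      by (rule nn_integral_restrict_space) simp
    also have "\<dots> = (\<integral>\<^sup>+x. h (a + 1 * x) * indicator {a - pi..<a + pi} (a + 1 * x) \<partial>lborel)"
      by (intro nn_integral_cong_AE, use AE_lborel_singleton[of pi] in eventually_elim)
         (auto simp: indicator_def add.commute)
    also have "\<dots> = I (a - pi) (a + pi)"
      unfolding I_def by (subst (2) nn_integral_real_affine[where c = 1 and t = a]) auto
    finally show ?thesis .
  qed
  define J where "J a = I (a - pi) (a + pi)" for a
  have step: "J s = J u" if "s \<le> u" "u \<le> s + 2 * pi" for s u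
  proof -
    have "I (s - pi) (s + pi) = I (s - pi) (u - pi) + I (u - pi) (s + pi)"
         "I (u - pi) (u + pi) = I (u - pi) (s + pi) + I (s + pi) (u + pi)"
      by (intro split; use that in simp)+
    moreover have "I (s + pi) (u + pi) = I (s - pi) (u - pi)"
      using shift[of "s - pi" "u - pi"] by (simp add: algebra_simps)
    ultimately show ?thesis by (simp add: J_def add.commute)
  qed
  have per_J: "J (s + 2 * pi) = J s" for s
    using step[of s "s + 2 * pi"] by simp
  have "J a = J (wrap a)" by (rule periodic_wrap[where h = J, OF per_J, symmetric])
  also have "\<dots> = J 0"
  proof -
    have "wrap a \<le> 0 + 2 * pi" "0 \<le> wrap a + 2 * pi" using wrap_mem[of a] by auto
    then show ?thesis
      using step[of 0 "wrap a"] step[of "wrap a" 0] by (metis linear)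
  qed
  finally show ?thesis using torus[of a] torus[of 0] by (simp add: J_def)
qed

section \<open>Minkowski's integral inequality\<close>

text \<open>A convex function lies above its tangent at \<open>c\<close>; this is the form of Jensen's inequality that
  the next proof integrates.\<close>

lemma powr_tangent_le:
  fixes p y c :: real
  assumes "1 \<le> p" "0 \<le> y" "0 < c"
  shows "c powr p + p * c powr (p - 1) * (y - c) \<le> y powr p"
proof (cases "y = 0")
  case True
  have "c powr p = c powr (p - 1) * c"
    using assms by (simp add: powr_diff)
  then have "c powr p + p * c powr (p - 1) * (y - c) = (1 - p) * c powr p"
    using True by (simp add: algebra_simps)
  also have "\<dots> \<le> 0" using assms by (intro mult_nonpos_nonneg) auto
  finally show ?thesis using True by simp
next
  case False
  have "y powr p - c powr p \<ge> p * c powr (p - 1) * (y - c)"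
  proof (rule convex_on_imp_above_tangent[OF powr_convex[OF assms(1)]])
    show "connected {0::real<..}" by simp
    show "c \<in> interior {0<..}" using assms by (simp add: interior_open)
    show "y \<in> {0<..}" using False assms by simp
    show "((\<lambda>x. x powr p) has_field_derivative p * c powr (p - 1)) (at c within {0<..})"
      by (rule has_field_derivative_at_within[OF has_real_derivative_powr]) (use assms in simp)
  qed
  then show ?thesis by simp
qed

text \<open>Minkowski's integral inequality, with the norm of each slice replaced by an upper bound \<open>w t\<close>.
  Write \<open>\<bar>F x t\<bar> = y x t * w t\<close>, so that every slice of \<open>y\<close> has \<open>p\<close>-norm at most 1.  For fixed \<open>x\<close>, Jensen's
  inequality for the measure \<open>w dM\<close> of mass \<open>W\<close> bounds the \<open>p\<close>-th power of \<open>\<integral> y w dM\<close> by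
  \<open>W powr (p - 1) * \<integral> y powr p * w dM\<close>, and Tonelli's theorem gives
  \<open>\<integral>\<integral> y powr p * w dM dN \<le> W\<close>.  The finiteness of almost every inner
  integral also yields the integrability of almost every \<open>F x\<close>.\<close>

lemma minkowski_Lp:
  fixes F :: "'a \<Rightarrow> 'b \<Rightarrow> real" and w :: "'b \<Rightarrow> real"
  assumes "sigma_finite_measure N" "sigma_finite_measure M" and p: "1 \<le> p"
    and [measurable]: "case_prod F \<in> borel_measurable (N \<Otimes>\<^sub>M M)"
    and w: "integrable M w" and w_nn: "\<And>t. 0 \<le> w t"
    and bound: "AE t in M. (\<integral>\<^sup>+x. ennreal (\<bar>F x t\<bar> powr p) \<partial>N) \<le> ennreal (w t powr p)"
  shows "AE x in N. integrable M (F x)" (is ?int)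
    and "(\<integral>\<^sup>+x. ennreal (\<bar>\<integral>t. F x t \<partial>M\<bar> powr p) \<partial>N) \<le> ennreal ((\<integral>t. w t \<partial>M) powr p)" (is ?le)
proof -
  interpret N: sigma_finite_measure N by fact
  interpret M: sigma_finite_measure M by fact
  interpret pair_sigma_finite N M ..
  have [measurable]: "w \<in> borel_measurable M" using w by auto
  define W where "W = (\<integral>t. w t \<partial>M)"
  have W_nn: "0 \<le> W" unfolding W_def using w_nn by simp
  define y where "y x t = \<bar>F x t\<bar> / w t" for x t
  have y_nn: "0 \<le> y x t" for x t unfolding y_def using w_nn by simp
  have [measurable]: "case_prod y \<in> borel_measurable (N \<Otimes>\<^sub>M M)"
    unfolding y_def by measurable
  define J where "J x = (\<integral>\<^sup>+t. ennreal (y x t powr p * w t) \<partial>M)" for x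
  have [measurable]: "J \<in> borel_measurable N" unfolding J_def by measurable
  (* Where w vanishes the quotient y is 0 by convention, so F itself must vanish there for F = y * w. *)
  have zero: "AE x in N. AE t in M. w t = 0 \<longrightarrow> F x t = 0"
  proof (subst AE_commute)
    show "{x \<in> space (N \<Otimes>\<^sub>M M). w (snd x) = 0 \<longrightarrow> F (fst x) (snd x) = 0} \<in> sets (N \<Otimes>\<^sub>M M)"
      by measurable
    show "AE t in M. AE x in N. w t = 0 \<longrightarrow> F x t = 0"
      using bound AE_space
    proof eventually_elim
      fix t assume t: "(\<integral>\<^sup>+x. ennreal (\<bar>F x t\<bar> powr p) \<partial>N) \<le> ennreal (w t powr p)"
        and [measurable]: "t \<in> space M"
      show "AE x in N. w t = 0 \<longrightarrow> F x t = 0"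
      proof (cases "w t = 0")
        case True
        then have "(\<integral>\<^sup>+x. ennreal (\<bar>F x t\<bar> powr p) \<partial>N) = 0" using t by simp
        then have "AE x in N. ennreal (\<bar>F x t\<bar> powr p) = 0"
          by (subst (asm) nn_integral_0_iff_AE) auto
        then show ?thesis by eventually_elim auto
      qed simp
    qed
  qed
  have J_int: "(\<integral>\<^sup>+x. J x \<partial>N) \<le> ennreal W"
  proof -
    have "(\<integral>\<^sup>+x. J x \<partial>N) = (\<integral>\<^sup>+t. (\<integral>\<^sup>+x. ennreal (y x t powr p * w t) \<partial>N) \<partial>M)"
      unfolding J_def by (rule Fubini'[symmetric]) measurable
    also have "\<dots> \<le> (\<integral>\<^sup>+t. ennreal (w t) \<partial>M)"
    proof (rule nn_integral_mono_AE, use bound AE_space in eventually_elim)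
      fix t assume t: "(\<integral>\<^sup>+x. ennreal (\<bar>F x t\<bar> powr p) \<partial>N) \<le> ennreal (w t powr p)"
        and [measurable]: "t \<in> space M"
      show "(\<integral>\<^sup>+x. ennreal (y x t powr p * w t) \<partial>N) \<le> ennreal (w t)"
      proof (cases "w t = 0")
        case False
        then have pos: "0 < w t" using w_nn[of t] by simp
        have "(\<integral>\<^sup>+x. ennreal (y x t powr p * w t) \<partial>N)
            = (\<integral>\<^sup>+x. ennreal (w t powr (1 - p)) * ennreal (\<bar>F x t\<bar> powr p) \<partial>N)"
          using pos by (intro nn_integral_cong)
            (simp add: y_def powr_divide powr_diff ennreal_mult[symmetric] field_simps)
        also have "\<dots> = ennreal (w t powr (1 - p)) * (\<integral>\<^sup>+x. ennreal (\<bar>F x t\<bar> powr p) \<partial>N)"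
          by (rule nn_integral_cmult) measurable
        also have "\<dots> \<le> ennreal (w t powr (1 - p)) * ennreal (w t powr p)"
          using t by (intro mult_left_mono) auto
        also have "\<dots> = ennreal (w t)"
          using pos by (simp add: ennreal_mult[symmetric] powr_add[symmetric])
        finally show ?thesis .
      qed simp
    qed
    also have "\<dots> = ennreal W"
      unfolding W_def using w w_nn by (intro nn_integral_eq_integral) auto
    finally show ?thesis .
  qed
  then have J_fin: "AE x in N. J x \<noteq> \<infinity>"
    by (intro nn_integral_noteq_infinite) (auto simp: top_unique)
  have key: "AE x in N. integrable M (F x) \<and>
      ennreal (\<bar>\<integral>t. F x t \<partial>M\<bar> powr p) \<le> ennreal (W powr (p - 1)) * J x"
    using zero J_fin AE_space
  proof eventually_elim
    fix x assume z: "AE t in M. w t = 0 \<longrightarrow> F x t = 0" and fin: "J x \<noteq> \<infinity>"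
      and [measurable]: "x \<in> space N"
    have F_eq: "AE t in M. \<bar>F x t\<bar> = y x t * w t"
      using z by eventually_elim (auto simp: y_def)
    have J': "integrable M (\<lambda>t. y x t powr p * w t)"
      using fin w_nn by (intro integrableI_nonneg) (auto simp: J_def top.not_eq_extremum)
    (* y is at most 1 + y^p, so the finiteness of J x makes F x integrable. *)
    have dom: "y x t * w t \<le> w t + y x t powr p * w t" for t
    proof -
      have "y x t \<le> 1 + y x t powr p"
      proof (cases "y x t \<le> 1")
        case False
        then have "y x t powr 1 \<le> y x t powr p" using p by (intro powr_mono) auto
        then show ?thesis using False by simp
      qed (simp add: add_increasing2)
      then show ?thesis using mult_right_mono[OF _ w_nn[of t], of "y x t" "1 + y x t powr p"]
        by (simp add: algebra_simps)
    qed
    have yw: "integrable M (\<lambda>t. y x t * w t)"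
      by (rule Bochner_Integration.integrable_bound[OF Bochner_Integration.integrable_add[OF w J']])
         (use dom w_nn y_nn in \<open>auto intro!: AE_I2\<close>)
    have absF: "integrable M (\<lambda>t. \<bar>F x t\<bar>)"
      using F_eq by (subst integrable_cong_AE[OF _ _ F_eq]) (auto intro: yw)
    then have Fint: "integrable M (F x)"
      by (subst (asm) integrable_abs_iff) auto
    define I where "I = (\<integral>t. y x t * w t \<partial>M)"
    have I_nn: "0 \<le> I" unfolding I_def using y_nn w_nn by simp
    have "\<bar>\<integral>t. F x t \<partial>M\<bar> \<le> (\<integral>t. \<bar>F x t\<bar> \<partial>M)" by (rule integral_abs_bound)
    also have "\<dots> = I" unfolding I_def by (intro integral_cong_AE F_eq) auto
    finally have le_I: "\<bar>\<integral>t. F x t \<partial>M\<bar> \<le> I" .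
    have I_le: "I powr p \<le> W powr (p - 1) * (\<integral>t. y x t powr p * w t \<partial>M)" (is "_ \<le> _ * ?J")
    proof (cases "I = 0")
      case False
      then have I_pos: "0 < I" using I_nn by simp
      have W_pos: "0 < W"
      proof (rule ccontr)
        assume "\<not> 0 < W"
        then have "W = 0" using W_nn by simp
        then have "AE t in M. w t = 0"
          unfolding W_def using w w_nn by (subst (asm) integral_nonneg_eq_0_iff_AE) auto
        then have "AE t in M. y x t * w t = 0" by eventually_elim simp
        then have "I = 0" unfolding I_def by (rule integral_eq_zero_AE)
        then show False using False by simp
      qed
      define c where "c = I / W"
      have c: "0 < c" unfolding c_def using I_pos W_pos by simp
      (* The tangent at the mean value c of y, integrated against w. *)
      have "(\<integral>t. (c powr p - p * c powr (p - 1) * c) * w t + p * c powr (p - 1) * (y x t * w t) \<partial>M)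
          \<le> ?J"
      proof (rule integral_mono)
        show "(c powr p - p * c powr (p - 1) * c) * w t + p * c powr (p - 1) * (y x t * w t)
            \<le> y x t powr p * w t" for t
          using mult_right_mono[OF powr_tangent_le[OF p y_nn[of x t] c] w_nn[of t]]
          by (simp add: algebra_simps)
      qed (use J' w yw in auto)
      also have "(\<integral>t. (c powr p - p * c powr (p - 1) * c) * w t + p * c powr (p - 1) * (y x t * w t) \<partial>M)
          = (c powr p - p * c powr (p - 1) * c) * W + p * c powr (p - 1) * I"
        using w yw by (simp add: W_def I_def)
      also have "\<dots> = c powr p * W"
        using W_pos by (simp add: c_def field_simps)
      finally have "W powr (p - 1) * (c powr p * W) \<le> W powr (p - 1) * ?J"
        by (intro mult_left_mono) auto
      moreover have "W powr (p - 1) * (c powr p * W) = I powr p"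
        using W_pos I_pos by (simp add: c_def powr_divide powr_diff)
      ultimately show ?thesis by simp
    qed (simp add: w_nn)
    have "\<bar>\<integral>t. F x t \<partial>M\<bar> powr p \<le> I powr p"
      using le_I p by (intro powr_mono2) auto
    then have "ennreal (\<bar>\<integral>t. F x t \<partial>M\<bar> powr p) \<le> ennreal (W powr (p - 1) * ?J)"
      using I_le by (intro ennreal_leI) linarith
    also have "\<dots> = ennreal (W powr (p - 1)) * J x"
      unfolding J_def using J' w_nn by (subst nn_integral_eq_integral) (auto simp: ennreal_mult)
    finally show "integrable M (F x) \<and>
      ennreal (\<bar>\<integral>t. F x t \<partial>M\<bar> powr p) \<le> ennreal (W powr (p - 1)) * J x"
      using Fint by simp
  qed
  then show ?int by eventually_elim simp
  have "(\<integral>\<^sup>+x. ennreal (\<bar>\<integral>t. F x t \<partial>M\<bar> powr p) \<partial>N) \<le> (\<integral>\<^sup>+x. ennreal (W powr (p - 1)) * J x \<partial>N)"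
    using key by (intro nn_integral_mono_AE) auto
  also have "\<dots> = ennreal (W powr (p - 1)) * (\<integral>\<^sup>+x. J x \<partial>N)" by (rule nn_integral_cmult) measurable
  also have "\<dots> \<le> ennreal (W powr (p - 1)) * ennreal W" by (intro mult_left_mono J_int) auto
  also have "\<dots> = ennreal (W powr p)"
    using W_nn by (cases "W = 0") (auto simp: ennreal_mult[symmetric] powr_diff)
  finally show ?le unfolding W_def .
qed

section \<open>Norm bounds in the three kinds of spaces\<close>

text \<open>The assertion \<open>norm_space X h \<le> c\<close>, in a form that makes sense before \<open>h\<close> is known to belong
  to the space, and that for the Lebesgue spaces does not see null sets.\<close>

fun bounded_in :: "fun_space \<Rightarrow> (real \<Rightarrow> real) \<Rightarrow> real \<Rightarrow> bool" where
  "bounded_in (Lp p) h c \<longleftrightarrow> (\<integral>\<^sup>+x. ennreal (\<bar>h x\<bar> powr p) \<partial>torus) \<le> ennreal (c powr p)"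
| "bounded_in Linf h c \<longleftrightarrow> (AE x in torus. \<bar>h x\<bar> \<le> c)"
| "bounded_in Cont h c \<longleftrightarrow> (\<forall>x. \<bar>h x\<bar> \<le> c)"

definition valid_space :: "fun_space \<Rightarrow> bool" where
  "valid_space X \<longleftrightarrow> (\<forall>p. X = Lp p \<longrightarrow> 1 \<le> p)"

lemma measurable_torus [measurable (raw)]:
  "f \<in> borel_measurable borel \<Longrightarrow> f \<in> borel_measurable torus"
  by (simp add: measurable_restrict_space1)

lemma measurable_torus_pair:
  assumes [measurable]: "case_prod F \<in> borel_measurable (borel \<Otimes>\<^sub>M M)"
  shows "case_prod F \<in> borel_measurable (torus \<Otimes>\<^sub>M M)"
proof -
  have "(\<lambda>z. (fst z, snd z)) \<in> torus \<Otimes>\<^sub>M M \<rightarrow>\<^sub>M borel \<Otimes>\<^sub>M M"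
    by (intro measurable_Pair measurable_compose[OF measurable_fst] measurable_snd measurable_restrict_space1) auto
  from measurable_compose[OF this assms] show ?thesis by (simp add: case_prod_unfold)
qed

lemma bounded_in_minus: "bounded_in X h c \<Longrightarrow> bounded_in X (\<lambda>x. - h x) c"
  by (cases X) auto

lemma bounded_in_mono:
  assumes "bounded_in X h c" "0 \<le> c" "c \<le> d" "valid_space X"
  shows "bounded_in X h d"
proof (cases X)
  case (Lp p)
  then have "c powr p \<le> d powr p"
    using assms by (intro powr_mono2) (auto simp: valid_space_def)
  then show ?thesis using assms Lp by (auto intro: order_trans ennreal_leI)
next
  case Linf
  then show ?thesis using assms by (auto elim!: eventually_mono)
next
  case Cont
  then show ?thesis using assms by (auto intro: order_trans)
qed

lemma bounded_in_translate:
  assumes "bounded_in X h c" and [measurable]: "h \<in> borel_measurable borel"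
    and per: "\<And>x. h (x + 2 * pi) = h x"
  shows "bounded_in X (\<lambda>x. h (x + a)) c"
proof (cases X)
  case (Lp p)
  have "(\<integral>\<^sup>+x. ennreal (\<bar>h (x + a)\<bar> powr p) \<partial>torus) = (\<integral>\<^sup>+x. ennreal (\<bar>h x\<bar> powr p) \<partial>torus)"
    by (rule nn_integral_torus_translate[where h = "\<lambda>x. ennreal (\<bar>h x\<bar> powr p)"]) (simp_all add: per)
  then show ?thesis using assms Lp by simp
next
  case Linf
  then have "AE x in lborel. \<bar>h x\<bar> \<le> c"
    using assms(1) by (intro AE_periodic) (auto simp: per)
  from AE_lborel_affine[OF this, of 1 a] show ?thesis
    by (simp add: Linf AE_torus_iff add.commute eventually_mono)
qed (use assms in auto)

text \<open>Minkowski's inequality in all three kinds of spaces: for essentially bounded functions it is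
  the exchange of two almost-everywhere quantifiers, for continuous functions it holds pointwise.\<close>

lemma bounded_in_integral:
  fixes F :: "real \<Rightarrow> 'b \<Rightarrow> real"
  assumes X: "valid_space X" and M: "sigma_finite_measure M"
    and meas: "case_prod F \<in> borel_measurable (borel \<Otimes>\<^sub>M M)"
    and w: "integrable M w" and w_nn: "\<And>t. 0 \<le> w t"
    and bound: "AE t in M. bounded_in X (\<lambda>x. F x t) (w t)"
  shows bounded_in_integral_bound: "bounded_in X (\<lambda>x. \<integral>t. F x t \<partial>M) (\<integral>t. w t \<partial>M)"
    and bounded_in_integral_integrable:
      "(\<And>x t. F (x + 2 * pi) t = F x t) \<Longrightarrow> pointwise_in X (\<lambda>x. integrable M (F x))"
proof -
  interpret M: sigma_finite_measure M by fact
  interpret T: sigma_finite_measure torus by (rule sigma_finite_torus)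
  interpret pair_sigma_finite torus M ..
  note [measurable] = measurable_torus_pair[OF meas]
  have [measurable]: "w \<in> borel_measurable M" using w by auto
  have lift: "AE x in lebesgue. integrable M (F x)"
    if "\<And>x t. F (x + 2 * pi) t = F x t" "AE x in torus. integrable M (F x)"
  proof -
    have "F (x + 2 * pi) = F x" for x using that(1) by (rule ext)
    then show ?thesis by (intro AE_completion AE_periodic that(2)) simp
  qed
  have row: "integrable M (F x) \<and> \<bar>\<integral>t. F x t \<partial>M\<bar> \<le> (\<integral>t. w t \<partial>M)"
    if "AE t in M. \<bar>F x t\<bar> \<le> w t" for x
  proof -
    have [measurable]: "F x \<in> borel_measurable M"
      using measurable_compose[OF measurable_Pair1' meas] by simp
    have int: "integrable M (F x)"
      by (rule Bochner_Integration.integrable_bound[OF w]) (use that w_nn in auto)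
    have "\<bar>\<integral>t. F x t \<partial>M\<bar> \<le> (\<integral>t. \<bar>F x t\<bar> \<partial>M)" by (rule integral_abs_bound)
    also have "\<dots> \<le> (\<integral>t. w t \<partial>M)"
      by (rule integral_mono_AE) (use int w that in auto)
    finally show ?thesis using int by simp
  qed
  have "bounded_in X (\<lambda>x. \<integral>t. F x t \<partial>M) (\<integral>t. w t \<partial>M) \<and>
    ((\<forall>x t. F (x + 2 * pi) t = F x t) \<longrightarrow> pointwise_in X (\<lambda>x. integrable M (F x)))"
  proof (cases X)
    case (Lp p)
    then have p: "1 \<le> p" using X by (simp add: valid_space_def)
    note mink = minkowski_Lp[OF sigma_finite_torus M p measurable_torus_pair[OF meas] w w_nn]
    have "AE t in M. (\<integral>\<^sup>+x. ennreal (\<bar>F x t\<bar> powr p) \<partial>torus) \<le> ennreal (w t powr p)"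
      using bound Lp by simp
    from mink(1)[OF this] mink(2)[OF this] show ?thesis
      using Lp lift by simp
  next
    case Linf
    have "AE x in torus. AE t in M. \<bar>F x t\<bar> \<le> w t"
      by (subst AE_commute) (use bound Linf in auto)
    then have "AE x in torus. integrable M (F x) \<and> \<bar>\<integral>t. F x t \<partial>M\<bar> \<le> (\<integral>t. w t \<partial>M)"
      by eventually_elim (rule row)
    then show ?thesis using Linf lift by (simp add: eventually_conj_iff)
  next
    case Cont
    have "AE t in M. \<bar>F x t\<bar> \<le> w t" for x
      using bound Cont by (auto elim: eventually_mono)
    then show ?thesis using Cont row by simp
  qed
  then show "bounded_in X (\<lambda>x. \<integral>t. F x t \<partial>M) (\<integral>t. w t \<partial>M)"
    and "(\<And>x t. F (x + 2 * pi) t = F x t) \<Longrightarrow> pointwise_in X (\<lambda>x. integrable M (F x))"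
    by auto
qed

text \<open>The triangle inequality is Minkowski's inequality for a counting measure.\<close>

lemma bounded_in_sum:
  fixes h :: "nat \<Rightarrow> real \<Rightarrow> real"
  assumes X: "valid_space X" and [measurable]: "\<And>j. h j \<in> borel_measurable borel"
    and "\<And>j. j < m \<Longrightarrow> bounded_in X (h j) c" and "0 \<le> c"
  shows "bounded_in X (\<lambda>x. \<Sum>j<m. h j x) (real m * c)"
proof -
  let ?M = "count_space {..<m}"
  have meas: "(\<lambda>(x, j). h j x) \<in> borel_measurable (borel \<Otimes>\<^sub>M ?M)"
    unfolding case_prod_unfold
    by (rule measurable_compose_countable'[where f = "\<lambda>j z. h j (fst z)" and g = snd]) auto
  have "bounded_in X (\<lambda>x. \<integral>j. h j x \<partial>?M) (\<integral>j. c \<partial>?M)"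
  proof (rule bounded_in_integral_bound[OF X _ meas])
    show "sigma_finite_measure ?M" by (rule sigma_finite_measure_count_space_finite) simp
    show "integrable ?M (\<lambda>_. c)" by (rule integrable_count_space) simp
  qed (use assms in \<open>auto simp: AE_count_space\<close>)
  then show ?thesis by (simp add: lebesgue_integral_count_space_finite)
qed

lemma bounded_in_add:
  assumes X: "valid_space X" and [measurable]: "h \<in> borel_measurable borel" "k \<in> borel_measurable borel"
    and "bounded_in X h c" "bounded_in X k c" and "0 \<le> c"
  shows "bounded_in X (\<lambda>x. h x + k x) (2 * c)"
proof -
  have "bounded_in X (\<lambda>x. \<Sum>j<2. (if j = (0::nat) then h else k) x) (real 2 * c)"
    by (rule bounded_in_sum) (use assms in auto)
  then show ?thesis by (simp add: numeral_2_eq_2)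
qed

lemma periodic_continuous_bdd:
  fixes h :: "real \<Rightarrow> real"
  assumes "continuous_on UNIV h" and per: "\<And>x. h (x + 2 * pi) = h x"
  shows "bdd_above (range (\<lambda>x. \<bar>h x\<bar>))"
proof -
  have "compact (h ` Q)"
    by (intro compact_continuous_image continuous_on_subset[OF assms(1)]) auto
  then have "bounded (h ` Q)" by (rule compact_imp_bounded)
  then obtain B where B: "\<forall>x\<in>Q. \<bar>h x\<bar> \<le> B" unfolding bounded_iff by auto
  have "\<bar>h x\<bar> \<le> B" for x
    using bspec[OF B, of "wrap x"] wrap_mem[of x] periodic_wrap[where h = h, OF per] by simp
  then show ?thesis by (intro bdd_aboveI2)
qed

lemma nn_integral_lebesgue_on_Q:
  "nn_integral (lebesgue_on Q) h = nn_integral torus h"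
  by (simp add: nn_integral_restrict_space nn_integral_completion)

lemma AE_lebesgue_on_Q_iff: "(AE x in lebesgue_on Q. P x) \<longleftrightarrow> (AE x in torus. P x)"
  by (simp add: AE_restrict_space_iff AE_completion_iff)

lemma measurable_lebesgue_on_Q:
  fixes f :: "real \<Rightarrow> real"
  shows "f \<in> borel_measurable lebesgue \<Longrightarrow> f \<in> borel_measurable (lebesgue_on Q)"
  by (rule measurable_restrict_space1)

lemma esssup_lebesgue_on_Q_nonneg:
  assumes "h \<in> borel_measurable (lebesgue_on Q)"
  shows "0 \<le> esssup (lebesgue_on Q) (\<lambda>t. ereal \<bar>h t\<bar>)"
proof -
  have "esssup (lebesgue_on Q) (\<lambda>t. 0 :: ereal) = 0"
    by (rule esssup_const) (simp add: emeasure_restrict_space space_restrict_space)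
  moreover have "esssup (lebesgue_on Q) (\<lambda>t. 0 :: ereal) \<le> esssup (lebesgue_on Q) (\<lambda>t. ereal \<bar>h t\<bar>)"
    by (rule esssup_mono) (auto simp: zero_ereal_def)
  ultimately show ?thesis by simp
qed

text \<open>Together with \<open>norm_space_le_bound\<close> below, this passes between \<open>bounded_in\<close> and membership
  with a norm bound.  The latter starts from a Borel function \<open>h\<close> and reaches every function \<open>g\<close> that
  equals \<open>h\<close> in the sense of the space, such as a limit that exists only almost everywhere.\<close>

lemma bounded_in_norm:
  assumes X: "valid_space X" and h: "in_space X h"
  shows "bounded_in X h (norm_space X h)" and "0 \<le> norm_space X h"
proof -
  have "bounded_in X h (norm_space X h) \<and> 0 \<le> norm_space X h"
  proof (cases X)
    case (Lp p)
    then have p: "1 \<le> p" using X by (simp add: valid_space_def)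
    have int: "integrable (lebesgue_on Q) (\<lambda>t. \<bar>h t\<bar> powr p)" using h Lp by simp
    have nn: "0 \<le> (LINT t|lebesgue_on Q. \<bar>h t\<bar> powr p)" by simp
    have "(\<integral>\<^sup>+x. ennreal (\<bar>h x\<bar> powr p) \<partial>torus) = ennreal (LINT t|lebesgue_on Q. \<bar>h t\<bar> powr p)"
      unfolding nn_integral_lebesgue_on_Q[symmetric] using int by (rule nn_integral_eq_integral) simp
    also have "\<dots> = ennreal (norm_space X h powr p)"
      using p nn by (simp add: Lp powr_powr)
    finally show ?thesis by (simp add: Lp)
  next
    case Linf
    let ?e = "esssup (lebesgue_on Q) (\<lambda>t. ereal \<bar>h t\<bar>)"
    have "0 \<le> ?e" "?e < \<infinity>" using h Linf esssup_lebesgue_on_Q_nonneg by auto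
    then obtain c where c: "?e = ereal c" "0 \<le> c" by (cases ?e) auto
    have "AE t in lebesgue_on Q. ereal \<bar>h t\<bar> \<le> ?e" by (rule esssup_AE)
    then show ?thesis by (simp add: Linf c AE_lebesgue_on_Q_iff)
  next
    case Cont
    then have "bdd_above (range (\<lambda>x. \<bar>h x\<bar>))" using h by (intro periodic_continuous_bdd) auto
    then have le: "\<bar>h x\<bar> \<le> (SUP x. \<bar>h x\<bar>)" for x by (rule cSUP_upper[OF UNIV_I])
    then have "0 \<le> (SUP x. \<bar>h x\<bar>)" using order_trans[OF abs_ge_zero] by blast
    then show ?thesis using le by (simp add: Cont)
  qed
  then show "bounded_in X h (norm_space X h)" "0 \<le> norm_space X h" by auto
qed

lemma AE_eq_borel_imp_lebesgue_measurable:
  fixes h :: "real \<Rightarrow> real"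
  assumes "h \<in> borel_measurable borel" "AE x in lebesgue. h x = g x"
  shows "g \<in> borel_measurable lebesgue"
  by (rule borel_measurable_AE[OF measurable_completion]) (use assms in auto)

lemma norm_space_le_bound:
  assumes X: "valid_space X" and [measurable]: "h \<in> borel_measurable borel"
    and eq: "pointwise_in X (\<lambda>x. h x = g x)"
    and b: "bounded_in X h c" and c: "0 \<le> c"
    and per: "\<And>x. g (x + 2 * pi) = g x"
    and cont: "X = Cont \<Longrightarrow> continuous_on UNIV g"
  shows "in_space X g \<and> norm_space X g \<le> c"
proof -
  have g [measurable]: "g \<in> borel_measurable (lebesgue_on Q)"
    if "AE x in lebesgue. h x = g x"
    by (rule measurable_lebesgue_on_Q[OF AE_eq_borel_imp_lebesgue_measurable[OF _ that]]) simp
  have AE_Q: "AE x in torus. h x = g x" if "AE x in lebesgue. h x = g x"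
    using that by (auto simp: AE_torus_iff AE_completion_iff elim: eventually_mono)
  show ?thesis
  proof (cases X)
    case (Lp p)
    then have p: "1 \<le> p" using X by (simp add: valid_space_def)
    have ae: "AE x in lebesgue. h x = g x" using eq Lp by simp
    note [measurable] = g[OF ae]
    have "(\<integral>\<^sup>+x. ennreal (\<bar>g x\<bar> powr p) \<partial>lebesgue_on Q) = (\<integral>\<^sup>+x. ennreal (\<bar>h x\<bar> powr p) \<partial>torus)"
      unfolding nn_integral_lebesgue_on_Q
      by (rule nn_integral_cong_AE) (use AE_Q[OF ae] in eventually_elim, simp)
    also have "\<dots> \<le> ennreal (c powr p)" using b Lp by simp
    finally have le: "(\<integral>\<^sup>+x. ennreal (\<bar>g x\<bar> powr p) \<partial>lebesgue_on Q) \<le> ennreal (c powr p)" .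
    then have int: "integrable (lebesgue_on Q) (\<lambda>x. \<bar>g x\<bar> powr p)"
      by (intro integrableI_nonneg) (auto intro: le_less_trans)
    have "ennreal (LINT x|lebesgue_on Q. \<bar>g x\<bar> powr p) \<le> ennreal (c powr p)"
      using le nn_integral_eq_integral[OF int] by simp
    then have "(LINT x|lebesgue_on Q. \<bar>g x\<bar> powr p) \<le> c powr p" by simp
    then have "(LINT x|lebesgue_on Q. \<bar>g x\<bar> powr p) powr (1 / p) \<le> (c powr p) powr (1 / p)"
      using p by (intro powr_mono2) auto
    also have "\<dots> = c" using p c by (simp add: powr_powr)
    finally show ?thesis using Lp int per by simp
  next
    case Linf
    have ae: "AE x in lebesgue. h x = g x" using eq Linf by simp
    note [measurable] = g[OF ae]
    have "AE x in torus. \<bar>g x\<bar> \<le> c"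
      using AE_Q[OF ae] b unfolding Linf bounded_in.simps by eventually_elim simp
    then have "AE x in lebesgue_on Q. ereal \<bar>g x\<bar> \<le> ereal c" by (simp add: AE_lebesgue_on_Q_iff)
    then have le: "esssup (lebesgue_on Q) (\<lambda>x. ereal \<bar>g x\<bar>) \<le> ereal c"
      by (intro esssup_I) auto
    moreover have "0 \<le> esssup (lebesgue_on Q) (\<lambda>x. ereal \<bar>g x\<bar>)"
      by (rule esssup_lebesgue_on_Q_nonneg) measurable
    ultimately obtain d where "esssup (lebesgue_on Q) (\<lambda>x. ereal \<bar>g x\<bar>) = ereal d" "d \<le> c"
      by (cases "esssup (lebesgue_on Q) (\<lambda>x. ereal \<bar>g x\<bar>)") auto
    then show ?thesis using Linf per g[OF ae] by simp
  next
    case Cont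
    have "h = g" using eq Cont by auto
    moreover have "(SUP x. \<bar>g x\<bar>) \<le> c"
      by (rule cSUP_least) (use b Cont \<open>h = g\<close> in auto)
    ultimately show ?thesis using Cont per cont by simp
  qed
qed

section \<open>The modulus of continuity\<close>

text \<open>The suprema that define the modulus of continuity are taken in the reals; the bound
  \<open>2 * norm_space X f\<close> makes them genuine.\<close>

lemma psi_bounded_in:
  assumes X: "valid_space X" and [measurable]: "f \<in> borel_measurable borel"
    and f: "in_space X f"
  shows "in_space X (\<lambda>x. psi f x t) \<and> norm_space X (\<lambda>x. psi f x t) \<le> 2 * norm_space X f"
proof (rule norm_space_le_bound[OF X])
  have per: "f (x + 2 * pi) = f x" for x using f by (cases X) auto
  note b = bounded_in_norm[OF X f]
  have "bounded_in X (\<lambda>x. f (x + t) + - f (x + - t)) (2 * norm_space X f)"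
    by (intro bounded_in_add[OF X] bounded_in_minus bounded_in_translate b per) auto
  then show "bounded_in X (\<lambda>x. psi f x t) (2 * norm_space X f)"
    by (simp add: psi_def)
  show "0 \<le> 2 * norm_space X f" using b by simp
  show "psi f (x + 2 * pi) t = psi f x t" for x
    using per[of "x + t"] per[of "x - t"] by (simp add: psi_def algebra_simps)
  show "pointwise_in X (\<lambda>x. psi f x t = psi f x t)" by (cases X) auto
  show "(\<lambda>x. psi f x t) \<in> borel_measurable borel" unfolding psi_def by measurable
  show "continuous_on UNIV (\<lambda>x. psi f x t)" if "X = Cont"
    using f that unfolding psi_def
    by (auto intro!: continuous_intros continuous_on_compose2[of UNIV f])
qed

context
  fixes X :: fun_space and f :: "real \<Rightarrow> real"
  assumes X: "valid_space X" and borel_f [measurable]: "f \<in> borel_measurable borel"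
    and f: "in_space X f"
begin

lemma modulus_bdd: "bdd_above ((\<lambda>t. norm_space X (\<lambda>x. psi f x t)) ` S)"
  using psi_bounded_in[OF X borel_f f] by (intro bdd_aboveI2[where M = "2 * norm_space X f"]) auto

lemma norm_psi_le_modulus:
  assumes "0 < t" "t \<le> d"
  shows "norm_space X (\<lambda>x. psi f x t) \<le> conj_modulus2 X f d"
proof -
  have "norm_space X (\<lambda>x. psi f x t) \<le> (SUP t\<in>{0<..d}. norm_space X (\<lambda>x. psi f x t))"
    by (rule cSUP_upper[OF _ modulus_bdd]) (use assms in simp)
  then show ?thesis using assms by (simp add: conj_modulus2_def)
qed

lemma modulus_nonneg: "0 \<le> conj_modulus2 X f d"
proof (cases "d \<le> 0")
  case False
  have "0 \<le> norm_space X (\<lambda>x. psi f x d)"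
    using psi_bounded_in[OF X borel_f f] bounded_in_norm(2)[OF X] by auto
  then show ?thesis using norm_psi_le_modulus[of d d] False by linarith
qed (simp add: conj_modulus2_def)

lemma modulus_mono: "mono (conj_modulus2 X f)"
proof (rule monoI)
  fix d e :: real assume "d \<le> e"
  show "conj_modulus2 X f d \<le> conj_modulus2 X f e"
  proof (cases "d \<le> 0")
    case True
    then show ?thesis using modulus_nonneg[of e] by (simp add: conj_modulus2_def)
  next
    case False
    have "(SUP t\<in>{0<..d}. norm_space X (\<lambda>x. psi f x t)) \<le> conj_modulus2 X f e"
      by (rule cSUP_least) (use False \<open>d \<le> e\<close> norm_psi_le_modulus in auto)
    then show ?thesis using False by (simp add: conj_modulus2_def)
  qed
qed

lemma psi_bounded_in_modulus:
  assumes "0 < t" "t \<le> d"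
  shows "bounded_in X (\<lambda>x. psi f x t) (conj_modulus2 X f d)"
proof -
  have "in_space X (\<lambda>x. psi f x t)" using psi_bounded_in[OF X borel_f f] by simp
  from bounded_in_norm[OF X this] show ?thesis
    by (rule bounded_in_mono) (use norm_psi_le_modulus[OF assms] X in auto)
qed

lemma psi_periodic: "psi f (x + 2 * pi) t = psi f x t"
proof -
  have per: "f (x + 2 * pi) = f x" for x using f by (cases X) auto
  show ?thesis
    using per[of "x + t"] per[of "x - t"] by (simp add: psi_def algebra_simps)
qed

text \<open>The symmetric difference with step \<open>m u\<close> telescopes into \<open>m\<close> translates of the symmetric
  difference with step \<open>u\<close>.  The modulus of continuity therefore decays at most linearly:
  \<open>\<omega>(\<pi>) \<le> \<mu> \<omega>(\<pi> / \<mu>)\<close>.\<close>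

lemma modulus_multiple:
  assumes m: "0 < m"
  shows "conj_modulus2 X f (real m * s) \<le> real m * conj_modulus2 X f s"
proof (cases "s \<le> 0")
  case True
  then have "real m * s \<le> 0" by (simp add: mult_nonneg_nonpos)
  then show ?thesis using True by (simp add: conj_modulus2_def)
next
  case False
  have "norm_space X (\<lambda>x. psi f x t) \<le> real m * conj_modulus2 X f s"
    if t: "0 < t" "t \<le> real m * s" for t
  proof -
    define u where "u = t / real m"
    have u: "0 < u" "u \<le> s" "t = real m * u" using t m by (simp_all add: u_def field_simps)
    have eq: "psi f x t = (\<Sum>j<m. psi f (x + ((2 * real j + 1) * u - t)) u)" for x
    proof -
      have "(\<Sum>j<m. psi f (x + ((2 * real j + 1) * u - t)) u)
          = (\<Sum>j<m. f (x - t + 2 * real (Suc j) * u) - f (x - t + 2 * real j * u))"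
        by (simp add: psi_def algebra_simps)
      also have "\<dots> = f (x - t + 2 * real m * u) - f (x - t + 2 * real 0 * u)"
        by (rule sum_lessThan_telescope)
      finally show ?thesis using u(3) by (simp add: psi_def algebra_simps)
    qed
    have [measurable]: "(\<lambda>x. psi f x u) \<in> borel_measurable borel" unfolding psi_def by measurable
    have b: "bounded_in X (\<lambda>x. psi f x t) (real m * conj_modulus2 X f s)"
      unfolding eq
    proof (intro bounded_in_sum[OF X] modulus_nonneg)
      fix j
      show "bounded_in X (\<lambda>x. psi f (x + ((2 * real j + 1) * u - t)) u) (conj_modulus2 X f s)"
        by (rule bounded_in_translate[where h = "\<lambda>x. psi f x u"])
           (use psi_bounded_in_modulus u psi_periodic in auto)
      show "(\<lambda>x. psi f (x + ((2 * real j + 1) * u - t)) u) \<in> borel_measurable borel"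
        unfolding psi_def by measurable
    qed
    have "in_space X (\<lambda>x. psi f x t) \<and> norm_space X (\<lambda>x. psi f x t) \<le> real m * conj_modulus2 X f s"
    proof (rule norm_space_le_bound[OF X _ _ b])
      show "(\<lambda>x. psi f x t) \<in> borel_measurable borel" unfolding psi_def by measurable
      show "pointwise_in X (\<lambda>x. psi f x t = psi f x t)" by (cases X) auto
      show "continuous_on UNIV (\<lambda>x. psi f x t)" if "X = Cont"
        using psi_bounded_in[OF X borel_f f, of t] that by simp
    qed (use modulus_nonneg psi_periodic in auto)
    then show ?thesis by simp
  qed
  moreover have "0 < real m * s" using m False by simp
  ultimately show ?thesis
    by (auto simp: conj_modulus2_def[of X f "real m * s"] not_le intro!: cSUP_least)
qed

end

section \<open>The conjugate Dirichlet kernel\<close>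

text \<open>Jordan's inequality: the concave sine lies above its chord.\<close>

lemma jordan_sin_ge:
  assumes "0 \<le> x" "x \<le> pi / 2"
  shows "2 * x / pi \<le> sin x"
proof -
  have "convex_on {0..pi/2} (\<lambda>x. - sin x)"
  proof (rule convex_on_realI)
    show "((\<lambda>x. - sin x) has_real_derivative - cos x) (at x)" for x
      by (auto intro!: derivative_eq_intros)
    show "- cos x \<le> - cos y" if "x \<in> {0..pi/2}" "y \<in> {0..pi/2}" "x \<le> y" for x y
      using that by (simp add: cos_monotone_0_pi_le)
  qed simp
  from convex_onD[OF this, of "2 * x / pi" 0 "pi / 2"] assms
  show ?thesis by (simp add: field_simps)
qed

lemma sin_half_ge: "0 \<le> t \<Longrightarrow> t \<le> pi \<Longrightarrow> t / pi \<le> sin (t / 2)"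
  using jordan_sin_ge[of "t / 2"] by simp

definition conj_dirichlet :: "nat \<Rightarrow> real \<Rightarrow> real" where
  "conj_dirichlet k t = (\<Sum>\<nu> = 1..k. sin (real \<nu> * t))"

lemma conj_dirichlet_closed:
  "2 * sin (t / 2) * conj_dirichlet k t = cos (t / 2) - cos ((real k + 1 / 2) * t)"
proof (induction k)
  case (Suc k)
  have "2 * sin (t / 2) * sin (real (Suc k) * t)
      = cos (real (Suc k) * t - t / 2) - cos (real (Suc k) * t + t / 2)"
    by (simp add: cos_add cos_diff)
  also have "\<dots> = cos ((real k + 1 / 2) * t) - cos ((real (Suc k) + 1 / 2) * t)"
    by (simp add: algebra_simps)
  finally show ?case
    using Suc by (simp add: conj_dirichlet_def algebra_simps)
qed (simp add: conj_dirichlet_def)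

lemma conj_dirichlet_eq_cot:
  assumes "0 < t" "t < 2 * pi"
  shows "conj_dirichlet k t = 1 / 2 * cot (t / 2) - cos ((real k + 1 / 2) * t) / (2 * sin (t / 2))"
proof -
  have "0 < sin (t / 2)" using assms by (intro sin_gt_zero) auto
  then show ?thesis
    using conj_dirichlet_closed[of t k] by (simp add: cot_def field_simps)
qed

lemma abs_conj_dirichlet_le: "\<bar>conj_dirichlet k t\<bar> \<le> real k"
proof -
  have "\<bar>conj_dirichlet k t\<bar> \<le> (\<Sum>\<nu> = 1..k. 1)"
    unfolding conj_dirichlet_def by (intro sum_abs[THEN order_trans] sum_mono) simp
  then show ?thesis by simp
qed

lemma abs_half_cot_le:
  assumes "0 < t" "t < pi"
  shows "\<bar>1 / 2 * cot (t / 2)\<bar> \<le> pi / (2 * t)"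
proof -
  have s: "t / pi \<le> sin (t / 2)" "0 < t / pi" using sin_half_ge[of t] assms by auto
  have "\<bar>1 / 2 * cot (t / 2)\<bar> \<le> 1 / 2 * (1 / sin (t / 2))"
    using s by (simp add: cot_def abs_mult divide_right_mono)
  also have "\<dots> \<le> 1 / 2 * (1 / (t / pi))"
    using s by (intro mult_left_mono divide_left_mono mult_pos_pos) auto
  finally show ?thesis by simp
qed

lemma abs_conj_dirichlet_le_inverse:
  assumes "0 < t" "t < pi"
  shows "\<bar>conj_dirichlet k t\<bar> \<le> pi / t"
proof -
  have s: "t / pi \<le> sin (t / 2)" "0 < t / pi" using sin_half_ge[of t] assms by auto
  have "2 * sin (t / 2) * \<bar>conj_dirichlet k t\<bar> = \<bar>cos (t / 2) - cos ((real k + 1 / 2) * t)\<bar>"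
    using s conj_dirichlet_closed[of t k, symmetric] by (simp add: abs_mult)
  also have "\<dots> \<le> 2"
    using abs_cos_le_one[of "t / 2"] abs_cos_le_one[of "(real k + 1 / 2) * t"] by linarith
  finally have "sin (t / 2) * \<bar>conj_dirichlet k t\<bar> \<le> 1" by simp
  then have "t / pi * \<bar>conj_dirichlet k t\<bar> \<le> 1"
    using mult_right_mono[OF s(1), of "\<bar>conj_dirichlet k t\<bar>"] by linarith
  then show ?thesis using assms by (simp add: field_simps)
qed

lemma conj_dirichlet_minus: "conj_dirichlet k (- t) = - conj_dirichlet k t"
  by (simp add: conj_dirichlet_def sum_negf)

lemma conj_dirichlet_measurable [measurable]: "conj_dirichlet k \<in> borel_measurable borel"
  unfolding conj_dirichlet_def[abs_def] by measurable

section \<open>Integral representations\<close>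

lemma integral_torus_translate:
  fixes h :: "real \<Rightarrow> real"
  assumes [measurable]: "h \<in> borel_measurable borel" and per: "\<And>x. h (x + 2 * pi) = h x"
    and int: "integrable torus h"
  shows integrable_torus_translate: "integrable torus (\<lambda>x. h (x + a))"
    and "(\<integral>x. h (x + a) \<partial>torus) = (\<integral>x. h x \<partial>torus)"
proof -
  have eq: "(\<integral>\<^sup>+x. ennreal (g (h (x + a))) \<partial>torus) = (\<integral>\<^sup>+x. ennreal (g (h x)) \<partial>torus)"
    if [measurable]: "g \<in> borel_measurable borel" for g :: "real \<Rightarrow> real"
    by (rule nn_integral_torus_translate[where h = "\<lambda>x. ennreal (g (h x))"]) (auto simp: per)
  show 1: "integrable torus (\<lambda>x. h (x + a))"
    using int eq[of abs] unfolding integrable_iff_bounded by simp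
  show "(\<integral>x. h (x + a) \<partial>torus) = (\<integral>x. h x \<partial>torus)"
    using eq[of "\<lambda>x. x"] eq[of uminus]
    by (simp add: real_lebesgue_integral_def[OF 1] real_lebesgue_integral_def[OF int])
qed

abbreviation half :: "real \<Rightarrow> real" where
  "half \<equiv> indicator {0<..<pi}"

lemma integral_torus_halves:
  fixes g :: "real \<Rightarrow> real"
  assumes [measurable]: "g \<in> borel_measurable borel" and int: "integrable torus g"
  shows integrable_half_pos: "integrable lborel (\<lambda>t. half t * g t)"
    and integrable_half_neg: "integrable lborel (\<lambda>t. half t * g (- t))"
    and "(\<integral>t. g t \<partial>torus) = (\<integral>t. half t * (g t + g (- t)) \<partial>lborel)"
proof -
  have Q: "integrable lborel (\<lambda>t. indicator Q t * g t)"
    using int by (simp add: integrable_restrict_space)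
  show 1: "integrable lborel (\<lambda>t. half t * g t)"
    by (rule Bochner_Integration.integrable_bound[OF Q]) (auto simp: indicator_def)
  have 2: "integrable lborel (\<lambda>t. indicator {-pi<..<0} t * g t)"
    by (rule Bochner_Integration.integrable_bound[OF Q]) (auto simp: indicator_def)
  have flip: "(\<lambda>t. indicator {-pi<..<0} (0 + -1 * t) * g (0 + -1 * t)) = (\<lambda>t. half t * g (- t))"
    by (auto simp: indicator_def fun_eq_iff)
  show 3: "integrable lborel (\<lambda>t. half t * g (- t))"
    using lborel_integrable_real_affine[OF 2, of "-1" 0] unfolding flip by simp
  have "(\<integral>t. g t \<partial>torus) = (\<integral>t. indicator Q t * g t \<partial>lborel)"
    by (simp add: integral_restrict_space)
  also have "\<dots> = (\<integral>t. half t * g t + indicator {-pi<..<0} t * g t \<partial>lborel)"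
  proof (rule integral_cong_AE)
    show "AE t in lborel. indicator Q t * g t = half t * g t + indicator {-pi<..<0} t * g t"
      using AE_lborel_singleton[of pi] AE_lborel_singleton[of "-pi"] AE_lborel_singleton[of "0::real"]
      by eventually_elim (auto simp: indicator_def)
  qed measurable
  also have "\<dots> = (\<integral>t. half t * g t \<partial>lborel) + (\<integral>t. indicator {-pi<..<0} t * g t \<partial>lborel)"
    using 1 2 by simp
  also have "(\<integral>t. indicator {-pi<..<0} t * g t \<partial>lborel) = (\<integral>t. half t * g (- t) \<partial>lborel)"
    using lborel_integral_real_affine[of "-1" "\<lambda>t. indicator {-pi<..<0} t * g t" 0] unfolding flip by simp
  finally show "(\<integral>t. g t \<partial>torus) = (\<integral>t. half t * (g t + g (- t)) \<partial>lborel)"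
    using 1 3 by (simp add: algebra_simps)
qed

text \<open>Every space \<open>X\<close> embeds into \<open>L\<^sup>1\<close>, so Fourier coefficients are integrals of integrable functions.\<close>

lemma in_space_integrable:
  assumes X: "valid_space X" and [measurable]: "f \<in> borel_measurable borel" and f: "in_space X f"
  shows "integrable torus f"
proof -
  interpret finite_measure torus by (rule finite_measure_torus)
  note b = bounded_in_norm[OF X f]
  show ?thesis
  proof (cases X)
    case (Lp p)
    then have p: "1 \<le> p" using X by (simp add: valid_space_def)
    have "integrable torus (\<lambda>x. \<bar>f x\<bar> powr p)"
      using b(1) Lp by (intro integrableI_nonneg) (auto intro: le_less_trans)
    then have int: "integrable torus (\<lambda>x. 1 + \<bar>f x\<bar> powr p)" by simp
    show ?thesis
    proof (rule Bochner_Integration.integrable_bound[OF int])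
      have "\<bar>f x\<bar> \<le> 1 + \<bar>f x\<bar> powr p" for x
      proof (cases "\<bar>f x\<bar> \<le> 1")
        case False
        then have "\<bar>f x\<bar> powr 1 \<le> \<bar>f x\<bar> powr p" using p by (intro powr_mono) auto
        then show ?thesis using False by simp
      qed (simp add: add_increasing2)
      then show "AE x in torus. norm (f x) \<le> norm (1 + \<bar>f x\<bar> powr p)" by simp
    qed simp
  next
    case Linf
    then show ?thesis
      using b(1) by (intro integrable_const_bound[where B = "norm_space X f"]) auto
  next
    case Cont
    then show ?thesis
      using b(1) by (intro integrable_const_bound[where B = "norm_space X f"]) auto
  qed
qed

text \<open>The kernel through which the deviation acts: \<open>\<integral> psi f x t * conj_kernel a d t dt\<close> is the mean
  of the conjugate partial sums with weights \<open>a\<close>, minus the conjugate function truncated at \<open>d\<close>.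
  The value \<open>d = 0\<close> corresponds to the conjugate function itself.\<close>

definition conj_kernel :: "(nat \<Rightarrow> real) \<Rightarrow> real \<Rightarrow> real \<Rightarrow> real" where
  "conj_kernel a d t = half t * (1 / pi) *
     (indicator {d..} t * (1 / 2 * cot (t / 2)) - (\<Sum>k. a k * conj_dirichlet k t))"

lemma cot_half_measurable [measurable]: "(\<lambda>t::real. cot (t / 2)) \<in> borel_measurable borel"
  unfolding cot_def by measurable

lemma conj_kernel_measurable [measurable]: "conj_kernel a d \<in> borel_measurable borel"
  unfolding conj_kernel_def[abs_def] by measurable

context
  fixes f :: "real \<Rightarrow> real"
  assumes borel_f [measurable]: "f \<in> borel_measurable borel"
    and per: "\<And>x. f (x + 2 * pi) = f x" and int_f: "integrable torus f"
begin

lemma psi_measurable: "psi f x \<in> borel_measurable borel"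
  unfolding psi_def[abs_def] by measurable

lemma translate_f:
  shows "integrable torus (\<lambda>t. f (x + t))"
  using integrable_torus_translate[OF borel_f per int_f, of x] by (simp add: add.commute)

lemma integrable_half_psi: "integrable lborel (\<lambda>t. half t * psi f x t)"
proof -
  have [measurable]: "(\<lambda>t. f (x + t)) \<in> borel_measurable borel" by measurable
  note h = integrable_half_pos[OF this translate_f] integrable_half_neg[OF this translate_f]
  from Bochner_Integration.integrable_diff[OF this] show ?thesis
    by (simp add: psi_def algebra_simps)
qed

lemma integrable_half_psi_bounded:
  assumes [measurable]: "k \<in> borel_measurable borel" and "\<And>t. 0 < t \<Longrightarrow> t < pi \<Longrightarrow> \<bar>k t\<bar> \<le> B"
  shows "integrable lborel (\<lambda>t. half t * (psi f x t * k t))"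
proof (rule Bochner_Integration.integrable_bound)
  note [measurable] = psi_measurable
  show "integrable lborel (\<lambda>t. B * (half t * psi f x t))" using integrable_half_psi by simp
  show "(\<lambda>t. half t * (psi f x t * k t)) \<in> borel_measurable lborel" by measurable
  have "\<bar>half t * (psi f x t * k t)\<bar> \<le> \<bar>B * (half t * psi f x t)\<bar>" for t
  proof (cases "0 < t \<and> t < pi")
    case True
    then have "\<bar>k t\<bar> \<le> \<bar>B\<bar>" using assms(2)[of t] by linarith
    then show ?thesis by (simp add: abs_mult mult_left_mono mult.commute[of "\<bar>B\<bar>"] mult.assoc)
  qed simp
  then show "AE t in lborel. norm (half t * (psi f x t * k t)) \<le> norm (B * (half t * psi f x t))"
    by simp
qed

text \<open>Insert the Fourier coefficients, translate by \<open>x\<close>, and use that the kernel is odd to fold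
  \<open>[-\<pi>, \<pi>]\<close> onto \<open>(0, \<pi>)\<close>, which produces \<open>psi\<close>.\<close>

lemma conj_partial_sum_eq_integral:
  "conj_partial_sum k f x = - (1 / pi) * (\<integral>t. half t * (psi f x t * conj_dirichlet k t) \<partial>lborel)"
proof -
  have int_mult: "integrable torus (\<lambda>t. f (c + t) * q t)"
    if [measurable]: "q \<in> borel_measurable borel" and "\<And>t. \<bar>q t\<bar> \<le> B" for q B c
  proof (rule Bochner_Integration.integrable_bound)
    show "integrable torus (\<lambda>t. B * f (c + t))" using translate_f by simp
    show "AE t in torus. norm (f (c + t) * q t) \<le> norm (B * f (c + t))"
      using that(2) by (intro AE_I2) (simp add: abs_mult mult.commute mult_right_mono order_trans[OF _ abs_ge_self])
  qed measurable
  have to_torus: "integral\<^sup>L (lebesgue_on Q) h = integral\<^sup>L torus h"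
    if [measurable]: "h \<in> borel_measurable borel" for h :: "real \<Rightarrow> real"
    by (simp add: integral_restrict_space integral_completion)
  have coeff: "fourier_cos f \<nu> * sin (real \<nu> * x) - fourier_sin f \<nu> * cos (real \<nu> * x)
      = - (1 / pi) * (\<integral>t. f (x + t) * sin (real \<nu> * t) \<partial>torus)" for \<nu>
  proof -
    have per_trig: "sin (real \<nu> * (u - 2 * pi)) = sin (real \<nu> * u)" for u
      using sin.minus_of_nat[of "real \<nu> * u" \<nu>] by (simp add: algebra_simps)
    have "fourier_cos f \<nu> * sin (real \<nu> * x) - fourier_sin f \<nu> * cos (real \<nu> * x)
        = 1 / pi * ((\<integral>u. f u * cos (real \<nu> * u) \<partial>torus) * sin (real \<nu> * x)
                  - (\<integral>u. f u * sin (real \<nu> * u) \<partial>torus) * cos (real \<nu> * x))"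
      by (simp add: fourier_cos_def fourier_sin_def to_torus algebra_simps)
    also have "(\<integral>u. f u * cos (real \<nu> * u) \<partial>torus) * sin (real \<nu> * x)
              - (\<integral>u. f u * sin (real \<nu> * u) \<partial>torus) * cos (real \<nu> * x)
        = (\<integral>u. f u * cos (real \<nu> * u) * sin (real \<nu> * x) - f u * sin (real \<nu> * u) * cos (real \<nu> * x) \<partial>torus)"
      using int_mult[of "\<lambda>u. cos (real \<nu> * u)" 1 0] int_mult[of "\<lambda>u. sin (real \<nu> * u)" 1 0] by simp
    also have "\<dots> = (\<integral>u. f u * - sin (real \<nu> * (u - x)) \<partial>torus)"
      by (intro Bochner_Integration.integral_cong) (simp_all add: sin_diff algebra_simps)
    also have "\<dots> = (\<integral>t. f (t + x) * - sin (real \<nu> * ((t + x) - x)) \<partial>torus)"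
    proof (rule integral_torus_translate(2)[symmetric])
      show "f (u + 2 * pi) * - sin (real \<nu> * (u + 2 * pi - x)) = f u * - sin (real \<nu> * (u - x))" for u
        using per[of u] per_trig[of "u + 2 * pi - x"] by (simp add: algebra_simps)
      show "integrable torus (\<lambda>u. f u * - sin (real \<nu> * (u - x)))"
        using int_mult[of "\<lambda>u. - sin (real \<nu> * (u - x))" 1 0] by simp
    qed measurable
    finally show ?thesis by (simp add: add.commute)
  qed
  have "conj_partial_sum k f x = - (1 / pi) * (\<Sum>\<nu> = 1..k. \<integral>t. f (x + t) * sin (real \<nu> * t) \<partial>torus)"
    unfolding conj_partial_sum_def coeff by (simp add: sum_distrib_left)
  also have "(\<Sum>\<nu> = 1..k. \<integral>t. f (x + t) * sin (real \<nu> * t) \<partial>torus)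
      = (\<integral>t. f (x + t) * conj_dirichlet k t \<partial>torus)"
    unfolding conj_dirichlet_def sum_distrib_left
    by (rule Bochner_Integration.integral_sum[symmetric], rule int_mult[where B = 1]) auto
  also have "\<dots> = (\<integral>t. half t * (f (x + t) * conj_dirichlet k t + f (x + - t) * conj_dirichlet k (- t)) \<partial>lborel)"
    by (rule integral_torus_halves(3), measurable, rule int_mult[where B = "real k"])
       (auto intro: abs_conj_dirichlet_le)
  also have "\<dots> = (\<integral>t. half t * (psi f x t * conj_dirichlet k t) \<partial>lborel)"
    by (simp add: conj_dirichlet_minus psi_def algebra_simps)
  finally show ?thesis .
qed

text \<open>Summation under the integral sign.  The bound \<open>b\<close> is used with two different values: a constant
  when the first moment of \<open>a\<close> is finite (then every \<open>x\<close> is admitted), and \<open>\<pi> / t\<close> when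
  \<open>psi f x t / t\<close> is integrable.\<close>

lemma conj_mean_sums_integral:
  fixes a :: "nat \<Rightarrow> real"
  assumes a: "\<And>k. 0 \<le> a k"
    and dom: "\<And>t N. 0 < t \<Longrightarrow> t < pi \<Longrightarrow> (\<Sum>k<N. a k * \<bar>conj_dirichlet k t\<bar>) \<le> b t"
    and int: "integrable lborel (\<lambda>t. half t * (\<bar>psi f x t\<bar> * b t))"
  shows "(\<lambda>k. a k * conj_partial_sum k f x) sums
      (- (1 / pi) * (\<integral>t. half t * (psi f x t * (\<Sum>k. a k * conj_dirichlet k t)) \<partial>lborel))"
proof -
  note [measurable] = psi_measurable
  have lim: "(\<lambda>N. \<integral>t. half t * (psi f x t * (\<Sum>k<N. a k * conj_dirichlet k t)) \<partial>lborel)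
      \<longlonglongrightarrow> (\<integral>t. half t * (psi f x t * (\<Sum>k. a k * conj_dirichlet k t)) \<partial>lborel)"
  proof (rule integral_dominated_convergence[OF _ _ int])
    show "AE t in lborel. (\<lambda>N. half t * (psi f x t * (\<Sum>k<N. a k * conj_dirichlet k t)))
        \<longlonglongrightarrow> half t * (psi f x t * (\<Sum>k. a k * conj_dirichlet k t))"
    proof (rule AE_I2)
      fix t
      show "(\<lambda>N. half t * (psi f x t * (\<Sum>k<N. a k * conj_dirichlet k t)))
        \<longlonglongrightarrow> half t * (psi f x t * (\<Sum>k. a k * conj_dirichlet k t))"
      proof (cases "0 < t \<and> t < pi")
        case True
        have "summable (\<lambda>k. norm (a k * conj_dirichlet k t))"
        proof (rule bounded_imp_summable)
          show "(\<Sum>k\<le>N. norm (a k * conj_dirichlet k t)) \<le> b t" for N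
            using dom[of t "Suc N"] True a by (simp add: abs_mult lessThan_Suc_atMost)
        qed simp
        then have "summable (\<lambda>k. a k * conj_dirichlet k t)" by (rule summable_norm_cancel)
        from summable_LIMSEQ[OF this] show ?thesis by (intro tendsto_intros)
      qed simp
    qed
    show "AE t in lborel. norm (half t * (psi f x t * (\<Sum>k<N. a k * conj_dirichlet k t)))
        \<le> half t * (\<bar>psi f x t\<bar> * b t)" for N
    proof (rule AE_I2)
      fix t
      show "norm (half t * (psi f x t * (\<Sum>k<N. a k * conj_dirichlet k t)))
          \<le> half t * (\<bar>psi f x t\<bar> * b t)"
      proof (cases "0 < t \<and> t < pi")
        case True
        have "\<bar>\<Sum>k<N. a k * conj_dirichlet k t\<bar> \<le> (\<Sum>k<N. a k * \<bar>conj_dirichlet k t\<bar>)"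
          using a by (intro sum_abs[THEN order_trans] sum_mono) (simp add: abs_mult)
        also have "\<dots> \<le> b t" using dom True by simp
        finally show ?thesis using True by (simp add: abs_mult mult_left_mono)
      qed simp
    qed
  qed measurable
  have "(\<Sum>k<N. a k * conj_partial_sum k f x)
      = - (1 / pi) * (\<integral>t. half t * (psi f x t * (\<Sum>k<N. a k * conj_dirichlet k t)) \<partial>lborel)" for N
  proof -
    have "(\<integral>t. half t * (psi f x t * (\<Sum>k<N. a k * conj_dirichlet k t)) \<partial>lborel)
        = (\<integral>t. (\<Sum>k<N. a k * (half t * (psi f x t * conj_dirichlet k t))) \<partial>lborel)"
      by (simp add: sum_distrib_left algebra_simps)
    also have "\<dots> = (\<Sum>k<N. a k * (\<integral>t. half t * (psi f x t * conj_dirichlet k t) \<partial>lborel))"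
      by (subst Bochner_Integration.integral_sum)
         (auto intro!: integrable_mult_right integrable_half_psi_bounded abs_conj_dirichlet_le)
    finally show ?thesis
      by (simp add: conj_partial_sum_eq_integral sum_distrib_left algebra_simps)
  qed
  then show ?thesis unfolding sums_def using tendsto_mult[OF tendsto_const lim, of "- (1 / pi)"] by simp
qed

lemma conj_trunc_eq_integral:
  assumes "0 < d"
  shows "conj_trunc f x d
    = - (1 / pi) * (\<integral>t. half t * (psi f x t * (indicator {d..} t * (1 / 2 * cot (t / 2)))) \<partial>lborel)"
proof -
  note [measurable] = psi_measurable
  have "(LINT t:{d..pi}|lebesgue. psi f x t * (1 / 2 * cot (t / 2)))
      = (\<integral>t. indicator {d..pi} t * (psi f x t * (1 / 2 * cot (t / 2))) \<partial>lborel)"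
    unfolding set_lebesgue_integral_def by (subst integral_completion) auto
  also have "\<dots> = (\<integral>t. half t * (psi f x t * (indicator {d..} t * (1 / 2 * cot (t / 2)))) \<partial>lborel)"
  proof (rule integral_cong_AE)
    show "AE t in lborel. indicator {d..pi} t * (psi f x t * (1 / 2 * cot (t / 2)))
       = half t * (psi f x t * (indicator {d..} t * (1 / 2 * cot (t / 2))))"
      using AE_lborel_singleton[of pi] by eventually_elim (use assms in \<open>auto simp: indicator_def\<close>)
  qed measurable
  finally show ?thesis by (simp add: conj_trunc_def)
qed

end

section \<open>Summation by parts with step r\<close>

definition r_variation :: "nat \<Rightarrow> (nat \<Rightarrow> real) \<Rightarrow> nat \<Rightarrow> real" where
  "r_variation r a m = (\<Sum>j. \<bar>a (m + j) - a (m + j + r)\<bar>)"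

lemma summable_shift_diff:
  fixes b :: "nat \<Rightarrow> real"
  assumes "\<And>j. 0 \<le> b j" "summable b"
  shows "summable (\<lambda>j. \<bar>b j - b (j + r)\<bar>)"
proof (rule summable_comparison_test')
  show "summable (\<lambda>j. b j + b (j + r))"
    using assms by (intro summable_add) (auto simp: summable_iff_shift)
  show "norm \<bar>b j - b (j + r)\<bar> \<le> b j + b (j + r)" for j
    using assms(1)[of j] assms(1)[of "j + r"] by simp
qed

lemma r_variation_nonneg:
  assumes a: "\<And>k. 0 \<le> a k" "summable a"
  shows "0 \<le> r_variation r a m"
proof -
  have "summable (\<lambda>j. \<bar>a (m + j) - a (m + j + r)\<bar>)"
    using summable_shift_diff[of "\<lambda>j. a (m + j)" r] a
    by (simp add: summable_iff_shift add.assoc[symmetric] add.commute[of m])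
  then show ?thesis unfolding r_variation_def by (rule suminf_nonneg) simp
qed

lemma sum_initial_le_variation:
  fixes b :: "nat \<Rightarrow> real"
  assumes "\<And>j. 0 \<le> b j" "summable b"
  shows "(\<Sum>j<r. b j) \<le> (\<Sum>j. \<bar>b j - b (j + r)\<bar>)"
proof -
  have sh: "summable (\<lambda>j. b (j + r))" using assms by (simp add: summable_iff_shift)
  have "(\<Sum>j<r. b j) = suminf b - (\<Sum>j. b (j + r))"
    using suminf_split_initial_segment[OF assms(2), of r] by simp
  also have "\<dots> = (\<Sum>j. b j - b (j + r))" by (rule suminf_diff[OF assms(2) sh])
  also have "\<dots> \<le> (\<Sum>j. \<bar>b j - b (j + r)\<bar>)"
    by (intro suminf_le summable_diff assms(2) sh summable_shift_diff assms) auto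
  finally show ?thesis .
qed

text \<open>Summation by parts with step \<open>r\<close>: the factor \<open>2 sin (r t / 2)\<close> turns \<open>cos (j t + c)\<close> into
  \<open>s (j + r) - s j\<close> with bounded \<open>s\<close>, and shifting the index moves the difference onto \<open>b\<close>.  The first
  \<open>r\<close> terms that this leaves over are dominated by the same variation, since their sum is \<open>\<Sum>j. b j - b (j + r)\<close>.\<close>

lemma abs_sin_mult_cos_series_le:
  fixes b :: "nat \<Rightarrow> real"
  assumes b: "\<And>j. 0 \<le> b j" "summable b"
  shows "\<bar>sin (real r * t / 2)\<bar> * \<bar>\<Sum>j. b j * cos (real j * t + c)\<bar> \<le> (\<Sum>j. \<bar>b j - b (j + r)\<bar>)"
proof -
  define s where "s j = sin (real j * t + c - real r * t / 2)" for j :: nat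
  have s: "\<bar>s j\<bar> \<le> 1" for j by (simp add: s_def)
  have sum_s: "summable (\<lambda>j. b (j + m) * s (j + l))" for m l
  proof (rule summable_comparison_test')
    show "summable (\<lambda>j. b (j + m))" using b by (simp add: summable_iff_shift)
    show "norm (b (j + m) * s (j + l)) \<le> b (j + m)" for j
      using mult_left_mono[OF s[of "j + l"] b(1)[of "j + m"]] b(1)[of "j + m"] by (simp add: abs_mult)
  qed
  have sum_c: "summable (\<lambda>j. b j * cos (real j * t + c))"
  proof (rule summable_comparison_test'[OF b(2)])
    show "norm (b j * cos (real j * t + c)) \<le> b j" for j
      using mult_left_mono[OF abs_cos_le_one b(1)[of j]] b(1)[of j] by (simp add: abs_mult)
  qed
  have prod: "2 * sin (real r * t / 2) * (b j * cos (real j * t + c)) = b j * s (j + r) - b j * s j" for j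
  proof -
    have "s (j + r) = sin ((real j * t + c) + real r * t / 2)"
      unfolding s_def by (simp add: algebra_simps)
    then have "s (j + r) - s j = 2 * sin (real r * t / 2) * cos (real j * t + c)"
      unfolding s_def by (simp add: sin_add sin_diff)
    then show ?thesis by (simp add: algebra_simps)
  qed
  have "2 * sin (real r * t / 2) * (\<Sum>j. b j * cos (real j * t + c))
      = (\<Sum>j. b j * s (j + r)) - (\<Sum>j. b j * s j)"
    using sum_s[of 0 r] sum_s[of 0 0]
    by (simp add: suminf_mult[OF sum_c, symmetric] prod suminf_diff)
  also have "(\<Sum>j. b j * s j) = (\<Sum>j. b (j + r) * s (j + r)) + (\<Sum>j<r. b j * s j)"
    by (rule suminf_split_initial_segment) (use sum_s[of 0 0] in simp)
  also have "(\<Sum>j. b j * s (j + r)) - ((\<Sum>j. b (j + r) * s (j + r)) + (\<Sum>j<r. b j * s j))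
      = (\<Sum>j. (b j - b (j + r)) * s (j + r)) - (\<Sum>j<r. b j * s j)"
    using sum_s[of 0 r] sum_s[of r r] by (simp add: suminf_diff left_diff_distrib)
  finally have eq: "2 * sin (real r * t / 2) * (\<Sum>j. b j * cos (real j * t + c))
      = (\<Sum>j. (b j - b (j + r)) * s (j + r)) - (\<Sum>j<r. b j * s j)" .
  have v: "summable (\<lambda>j. \<bar>b j - b (j + r)\<bar>)" by (rule summable_shift_diff) (use b in auto)
  have le: "\<bar>(b j - b (j + r)) * s (j + r)\<bar> \<le> \<bar>b j - b (j + r)\<bar>" for j
    using mult_left_mono[OF s[of "j + r"], of "\<bar>b j - b (j + r)\<bar>"] by (simp add: abs_mult)
  have sle: "summable (\<lambda>j. \<bar>(b j - b (j + r)) * s (j + r)\<bar>)"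
    by (rule summable_comparison_test'[OF v]) (use le in simp)
  have "\<bar>\<Sum>j. (b j - b (j + r)) * s (j + r)\<bar> \<le> (\<Sum>j. \<bar>(b j - b (j + r)) * s (j + r)\<bar>)"
    by (rule summable_rabs[OF sle])
  also have "\<dots> \<le> (\<Sum>j. \<bar>b j - b (j + r)\<bar>)"
    by (rule suminf_le[OF le sle v])
  finally have 1: "\<bar>\<Sum>j. (b j - b (j + r)) * s (j + r)\<bar> \<le> (\<Sum>j. \<bar>b j - b (j + r)\<bar>)" .
  have "\<bar>\<Sum>j<r. b j * s j\<bar> \<le> (\<Sum>j<r. b j)"
  proof (intro sum_abs[THEN order_trans] sum_mono)
    show "\<bar>b j * s j\<bar> \<le> b j" for j
      using mult_left_mono[OF s[of j] b(1)[of j]] b(1)[of j] by (simp add: abs_mult)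
  qed
  also have "\<dots> \<le> (\<Sum>j. \<bar>b j - b (j + r)\<bar>)" by (rule sum_initial_le_variation) (use b in auto)
  finally have 2: "\<bar>\<Sum>j<r. b j * s j\<bar> \<le> (\<Sum>j. \<bar>b j - b (j + r)\<bar>)" .
  have "2 * (\<bar>sin (real r * t / 2)\<bar> * \<bar>\<Sum>j. b j * cos (real j * t + c)\<bar>)
      = \<bar>2 * sin (real r * t / 2) * (\<Sum>j. b j * cos (real j * t + c))\<bar>"
    by (simp add: abs_mult)
  also have "\<dots> \<le> 2 * (\<Sum>j. \<bar>b j - b (j + r)\<bar>)"
    unfolding eq using 1 2 by linarith
  finally show ?thesis by simp
qed

text \<open>For weights with sum 1, the numerator of the kernel on \<open>[d, \<pi>)\<close>, whose denominator is
  \<open>2\<pi> sin (t / 2)\<close>.\<close>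

definition cos_mean :: "(nat \<Rightarrow> real) \<Rightarrow> real \<Rightarrow> real" where
  "cos_mean a t = (\<Sum>k. a k * cos ((real k + 1 / 2) * t))"

lemma summable_cos_mean:
  assumes a: "\<And>k. 0 \<le> a k" "summable a"
  shows "summable (\<lambda>k. a k * cos ((real k + 1 / 2) * t))"
proof (rule summable_comparison_test'[OF a(2)])
  show "norm (a k * cos ((real k + 1 / 2) * t)) \<le> a k" for k
    using mult_left_mono[OF abs_cos_le_one a(1)[of k]] a(1)[of k] by (simp add: abs_mult)
qed

lemma cos_mean_measurable [measurable]: "cos_mean a \<in> borel_measurable borel"
  unfolding cos_mean_def[abs_def] by measurable

lemma abs_cos_mean_le_1:
  assumes a: "\<And>k. 0 \<le> a k" "a sums 1"
  shows "\<bar>cos_mean a t\<bar> \<le> 1"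
proof -
  have sm: "summable a" "suminf a = 1" using a(2) by (auto simp: sums_iff)
  have le: "\<bar>a k * cos ((real k + 1 / 2) * t)\<bar> \<le> a k" for k
    using mult_left_mono[OF abs_cos_le_one a(1)[of k]] a(1)[of k] by (simp add: abs_mult)
  have s: "summable (\<lambda>k. \<bar>a k * cos ((real k + 1 / 2) * t)\<bar>)"
    by (rule summable_comparison_test'[OF sm(1)]) (use le in simp)
  have "\<bar>cos_mean a t\<bar> \<le> (\<Sum>k. \<bar>a k * cos ((real k + 1 / 2) * t)\<bar>)"
    unfolding cos_mean_def by (rule summable_rabs[OF s])
  also have "\<dots> \<le> 1" using suminf_le[OF le s sm(1)] sm(2) by simp
  finally show ?thesis .
qed

lemma abs_cos_mean_le:
  assumes a: "\<And>k. 0 \<le> a k" "summable a"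
  shows "\<bar>sin (real r * t / 2)\<bar> * \<bar>cos_mean a t\<bar>
    \<le> \<bar>sin (real r * t / 2)\<bar> * (\<Sum>k<m. a k) + r_variation r a m"
proof -
  let ?c = "\<lambda>k. a k * cos ((real k + 1 / 2) * t)"
  have "cos_mean a t = (\<Sum>j. ?c (j + m)) + (\<Sum>k<m. ?c k)"
    unfolding cos_mean_def by (rule suminf_split_initial_segment[OF summable_cos_mean[OF a]])
  then have "\<bar>sin (real r * t / 2)\<bar> * \<bar>cos_mean a t\<bar>
      \<le> \<bar>sin (real r * t / 2)\<bar> * (\<bar>\<Sum>j. ?c (j + m)\<bar> + \<bar>\<Sum>k<m. ?c k\<bar>)"
    by (intro mult_left_mono) auto
  moreover have "\<bar>sin (real r * t / 2)\<bar> * \<bar>\<Sum>j. ?c (j + m)\<bar> \<le> r_variation r a m"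
    using abs_sin_mult_cos_series_le[of "\<lambda>j. a (j + m)" r t "(real m + 1 / 2) * t"] a
    by (simp add: summable_iff_shift r_variation_def algebra_simps)
  moreover have "\<bar>\<Sum>k<m. ?c k\<bar> \<le> (\<Sum>k<m. a k)"
  proof (intro sum_abs[THEN order_trans] sum_mono)
    show "\<bar>?c k\<bar> \<le> a k" for k
      using mult_left_mono[OF abs_cos_le_one a(1)[of k]] a(1)[of k] by (simp add: abs_mult)
  qed
  then have "\<bar>sin (real r * t / 2)\<bar> * \<bar>\<Sum>k<m. ?c k\<bar> \<le> \<bar>sin (real r * t / 2)\<bar> * (\<Sum>k<m. a k)"
    by (intro mult_left_mono) auto
  ultimately show ?thesis by (simp add: algebra_simps)
qed

text \<open>The factor \<open>\<bar>sin (r t / 2)\<bar>\<close> is comparable to the distance of \<open>t\<close> from its nearest zero \<open>2\<pi>l / r\<close>.  At a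
  distance of order \<open>1 / \<mu>\<close> the best place to split the series is at \<open>\<mu>\<close>: the head is bounded trivially, the
  tail by summation by parts.\<close>

lemma abs_cos_mean_cell_le:
  fixes r l \<mu> :: nat
  assumes a: "\<And>k. 0 \<le> a k" "summable a" and r: "0 < r" and \<mu>: "1 \<le> \<mu>"
    and s: "pi / (real r * (real \<mu> + 1)) < \<bar>t - 2 * pi * real l / real r\<bar>"
      "\<bar>t - 2 * pi * real l / real r\<bar> \<le> pi / real r"
  shows "\<bar>cos_mean a t\<bar> \<le> 2 * ((\<Sum>k = 0..\<mu> + 1. a k) + real \<mu> * r_variation r a \<mu>)"
proof -
  define d where "d = t - 2 * pi * real l / real r"
  have "real r * t / 2 = real r * d / 2 + real l * pi"
    using r by (simp add: d_def field_simps)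
  then have "\<bar>sin (real r * t / 2)\<bar> = \<bar>sin (real r * d / 2)\<bar>"
    by (simp only: sin_add abs_mult sin_npi cos_npi) (simp add: abs_mult)
  also have "\<dots> = \<bar>sin (real r * \<bar>d\<bar> / 2)\<bar>"
    by (cases "0 \<le> d") auto
  finally have sin_eq: "\<bar>sin (real r * t / 2)\<bar> = \<bar>sin (real r * \<bar>d\<bar> / 2)\<bar>" .
  note sd = s[folded d_def]
  have "real r * \<bar>d\<bar> / pi \<le> sin (real r * \<bar>d\<bar> / 2)"
    using jordan_sin_ge[of "real r * \<bar>d\<bar> / 2"] sd(2) r by (simp add: field_simps)
  moreover have "1 / (real \<mu> + 1) < real r * \<bar>d\<bar> / pi"
  proof -
    have "pi < \<bar>d\<bar> * (real r * (real \<mu> + 1))"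
      using sd(1) r by (subst (asm) pos_divide_less_eq) auto
    then show ?thesis by (simp add: field_simps)
  qed
  moreover have "1 / (2 * real \<mu>) \<le> 1 / (real \<mu> + 1)"
    using \<mu> by (simp add: field_simps)
  ultimately have lower: "1 / (2 * real \<mu>) \<le> \<bar>sin (real r * t / 2)\<bar>"
    unfolding sin_eq by linarith
  have pos: "0 < \<bar>sin (real r * t / 2)\<bar>"
    using lower \<mu> by (intro less_le_trans[OF _ lower]) simp
  note v_nn = r_variation_nonneg[OF a, of r \<mu>]
  have "\<bar>cos_mean a t\<bar> \<le> (\<Sum>k<\<mu>. a k) + r_variation r a \<mu> / \<bar>sin (real r * t / 2)\<bar>"
    using abs_cos_mean_le[OF a, where r = r and t = t and m = \<mu>] pos by (simp add: field_simps)
  also have "r_variation r a \<mu> / \<bar>sin (real r * t / 2)\<bar> \<le> r_variation r a \<mu> / (1 / (2 * real \<mu>))"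
    using pos \<mu> by (intro divide_left_mono[OF lower v_nn] mult_pos_pos) auto
  also have "(\<Sum>k<\<mu>. a k) \<le> (\<Sum>k = 0..\<mu> + 1. a k)"
    by (rule sum_mono2) (use a in auto)
  finally have "\<bar>cos_mean a t\<bar> \<le> (\<Sum>k = 0..\<mu> + 1. a k) + 2 * real \<mu> * r_variation r a \<mu>"
    by (simp add: mult.commute)
  moreover have "0 \<le> (\<Sum>k = 0..\<mu> + 1. a k)" using a by (intro sum_nonneg) auto
  ultimately show ?thesis by simp
qed

text \<open>The quantity \<open>rate\<close> for an arbitrary function in place of the modulus of continuity, with the
  two sums joined.\<close>

definition abs_rate :: "(real \<Rightarrow> real) \<Rightarrow> (nat \<Rightarrow> real) \<Rightarrow> nat \<Rightarrow> nat \<Rightarrow> real" where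
  "abs_rate w a r n = w (pi / (real n + 1))
     + (\<Sum>\<mu> = 1..n. w (pi / real \<mu>) / real \<mu> * ((\<Sum>k = 0..\<mu> + 1. a k) + real \<mu> * r_variation r a \<mu>))"

text \<open>The interval is cut into the zones \<open>\<pi> / (r(\<mu> + 1)) < \<bar>t - 2\<pi>l / r\<bar> \<le> \<pi> / (r\<mu>)\<close> around all zeros of
  \<open>sin (r t / 2)\<close>.  Around the zero at the origin (\<open>l = 0\<close>) the zone \<open>\<mu>\<close> has length of order \<open>\<mu>\<^sup>-\<^sup>2\<close> and
  \<open>w t / t\<close> is of order at most \<open>\<mu> w(\<pi> / \<mu>)\<close> there, which gives exactly the term \<open>\<mu>\<close> of the sum.
  Around the other zeros \<open>w t / t\<close> is only bounded by a multiple of \<open>w \<pi>\<close>, but \<open>w \<pi> \<le> \<mu> w(\<pi> / \<mu>)\<close>,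
  so their zones contribute no more than those at the origin.  The discs of radius \<open>\<pi> / (r(n + 1))\<close>
  that remain around the zeros \<open>l \<ge> 1\<close> are covered by the trivial bound 1 for the cosine mean and contribute at
  most a multiple of \<open>w \<pi> / (n + 1) \<le> w(\<pi> / (n + 1))\<close>.\<close>

lemma cos_mean_integral_le:
  fixes w :: "real \<Rightarrow> real"
  assumes w: "mono w" "\<And>t. 0 \<le> w t" "\<And>m s. 0 < m \<Longrightarrow> w (real m * s) \<le> real m * w s"
    and a: "\<And>k. 0 \<le> a k" "a sums 1" and r: "0 < r"
  shows "(\<integral>\<^sup>+t\<in>{pi / (real r * (real n + 1))<..<pi}. ennreal (w t * \<bar>cos_mean a t\<bar> / t) \<partial>lborel)
    \<le> ennreal (4 * (real r + 1) * abs_rate w a r n)"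
proof -
  have sm: "summable a" using a(2) by (simp add: sums_iff)
  define B where "B \<mu> = (\<Sum>k = 0..\<mu> + 1. a k) + real \<mu> * r_variation r a \<mu>" for \<mu>
  note v_nn = r_variation_nonneg[OF a(1) sm, of r]
  have B_nn: "0 \<le> B \<mu>" for \<mu> unfolding B_def using a v_nn by (intro add_nonneg_nonneg sum_nonneg) auto
  define p where "p l = 2 * pi * real l / real r" for l :: nat
  define v where "v \<mu> = pi / (real r * real \<mu>)" for \<mu> :: nat
  define c where "c \<mu> = w (pi / real \<mu>) * real r * (real \<mu> + 1) / pi * (2 * B \<mu>)" for \<mu>
  have c_nn: "0 \<le> c \<mu>" for \<mu> unfolding c_def using w(2) B_nn by simp
  define c0 where "c0 = w pi * real r / pi"
  have c0_nn: "0 \<le> c0" unfolding c0_def using w(2) by simp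
  define ring :: "nat \<Rightarrow> nat \<Rightarrow> real \<Rightarrow> real" where
    "ring l \<mu> t = indicator {p l + v (\<mu> + 1)<..p l + v \<mu>} t
                + indicator {p l - v \<mu>..<p l - v (\<mu> + 1)} t" for l \<mu> t
  define disc :: "nat \<Rightarrow> real \<Rightarrow> real" where
    "disc l = indicator {p l - v (n + 1)..p l + v (n + 1)}" for l
  have ring_nn: "0 \<le> ring l \<mu> t" for l \<mu> t unfolding ring_def by simp
  have disc_nn: "0 \<le> disc l t" for l t unfolding disc_def by simp
  define S where "S t = (\<Sum>l\<le>r. \<Sum>\<mu> = 1..n. c \<mu> * ring l \<mu> t) + (\<Sum>l = 1..r. c0 * disc l t)" for t
  have S1_nn: "0 \<le> (\<Sum>l\<le>r. \<Sum>\<mu> = 1..n. c \<mu> * ring l \<mu> t)" for t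
    by (intro sum_nonneg mult_nonneg_nonneg c_nn ring_nn)
  have S2_nn: "0 \<le> (\<Sum>l = 1..r. c0 * disc l t)" for t
    by (intro sum_nonneg mult_nonneg_nonneg c0_nn disc_nn)
  have pointwise: "w t * \<bar>cos_mean a t\<bar> / t \<le> S t"
    if t: "pi / (real r * (real n + 1)) < t" "t < pi" for t
  proof -
    have t0: "0 < t" using t(1) r by (intro less_trans[OF _ t(1)]) simp
    (* The zero nearest to t. *)
    define l where "l = nat \<lfloor>real r * t / (2 * pi) + 1 / 2\<rfloor>"
    have "0 \<le> real r * t / (2 * pi)" using t0 by simp
    then have "of_int \<lfloor>real r * t / (2 * pi) + 1 / 2\<rfloor> = real l" unfolding l_def by simp
    then have l: "real l \<le> real r * t / (2 * pi) + 1 / 2" "real r * t / (2 * pi) + 1 / 2 < real l + 1"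
      by linarith+
    have "real r * t / (2 * pi) < real r / 2"
      using t r by (simp add: field_simps)
    then have "real l < real r + 1" using l(1) r by linarith
    then have l_le: "l \<le> r" by linarith
    define s where "s = \<bar>t - p l\<bar>"
    have "t - p l = (real r * t / (2 * pi) - real l) * (2 * pi / real r)"
      using r by (simp add: p_def field_simps)
    then have "s = \<bar>real r * t / (2 * pi) - real l\<bar> * (2 * pi / real r)"
      by (simp add: s_def abs_mult)
    also have "\<dots> \<le> 1 / 2 * (2 * pi / real r)"
    proof (rule mult_right_mono)
      show "\<bar>real r * t / (2 * pi) - real l\<bar> \<le> 1 / 2" using l by linarith
    qed simp
    finally have s_le: "s \<le> pi / real r" by simp
    have far: "pi / real r \<le> t" if "1 \<le> l"
    proof -
      have "2 * pi / real r \<le> p l" using that r by (simp add: p_def divide_right_mono)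
      then show ?thesis using s_le unfolding s_def by linarith
    qed
    have w_far: "w t / t \<le> w pi * real r / pi" if "1 \<le> l"
    proof -
      have "w t / t \<le> w pi / (pi / real r)"
        using far[OF that] t t0 r w(2) by (intro frac_le monoD[OF w(1)]) auto
      then show ?thesis by simp
    qed
    show ?thesis
    proof (cases "s \<le> v (n + 1)")
      case True
      (* The disc around the origin is cut off by the lower limit of integration. *)
      have "1 \<le> l"
      proof (rule ccontr)
        assume "\<not> 1 \<le> l"
        then have "s = t" using t0 by (simp add: s_def p_def not_le)
        then show False using True t(1) by (simp add: v_def add.commute)
      qed
      have "w t * \<bar>cos_mean a t\<bar> / t \<le> w t / t * 1"
        using mult_left_mono[OF abs_cos_mean_le_1[OF a], of "w t / t" t] w(2)[of t] t0 by simp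
      also have "\<dots> \<le> c0 * disc l t"
        using w_far[OF \<open>1 \<le> l\<close>] True by (auto simp: c0_def disc_def s_def indicator_def)
      also have "\<dots> \<le> (\<Sum>l = 1..r. c0 * disc l t)"
        by (rule member_le_sum) (use l_le \<open>1 \<le> l\<close> c0_nn disc_nn in auto)
      finally show ?thesis unfolding S_def using S1_nn[of t] by linarith
    next
      case False
      (* The index of the zone that contains t. *)
      define \<mu> where "\<mu> = nat \<lfloor>pi / (real r * s)\<rfloor>"
      have "0 < v (n + 1)" using r by (simp add: v_def)
      then have s0: "0 < s" using False by linarith
      have "0 \<le> pi / (real r * s)" using s0 by simp
      then have "of_int \<lfloor>pi / (real r * s)\<rfloor> = real \<mu>" unfolding \<mu>_def by simp
      then have \<mu>: "real \<mu> \<le> pi / (real r * s)" "pi / (real r * s) < real \<mu> + 1"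
        by linarith+
      have "1 \<le> pi / (real r * s)" using s_le s0 r by (simp add: field_simps)
      then have "0 < real \<mu>" using \<mu>(2) by linarith
      then have \<mu>1: "1 \<le> \<mu>" by simp
      have "pi / (real r * (real n + 1)) < s"
        using False by (simp add: v_def add.commute)
      then have "pi < s * (real r * (real n + 1))"
        using r by (subst (asm) pos_divide_less_eq) auto
      then have "pi / (real r * s) < real n + 1"
        using s0 r by (simp add: field_simps)
      then have \<mu>n: "\<mu> \<le> n" using \<mu>(1) by linarith
      have "pi < s * (real r * real (\<mu> + 1))" using \<mu>(2) s0 r by (simp add: field_simps)
      then have sv: "v (\<mu> + 1) < s" "s \<le> v \<mu>"
        using \<mu>(1) s0 r \<mu>1 unfolding v_def
        by (subst pos_divide_less_eq, simp_all) (simp add: field_simps)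
      have cos_le: "\<bar>cos_mean a t\<bar> \<le> 2 * B \<mu>"
        unfolding B_def
        by (rule abs_cos_mean_cell_le[OF a(1) sm r \<mu>1, where l = l])
           (use sv(1) s_le in \<open>simp_all add: s_def p_def v_def add.commute\<close>)
      have w_le: "w t / t \<le> w (pi / real \<mu>) * real r * (real \<mu> + 1) / pi"
      proof (cases "1 \<le> l")
        case True
        have "w pi \<le> real \<mu> * w (pi / real \<mu>)" using w(3)[of \<mu> "pi / real \<mu>"] \<mu>1 by simp
        also have "\<dots> \<le> w (pi / real \<mu>) * (real \<mu> + 1)"
          using w(2)[of "pi / real \<mu>"] by (simp add: algebra_simps)
        finally have "w pi * real r / pi \<le> (w (pi / real \<mu>) * (real \<mu> + 1)) * real r / pi"
          by (intro divide_right_mono mult_right_mono) auto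
        then show ?thesis using w_far[OF True] by (simp add: mult_ac)
      next
        case False
        then have ts: "t = s" using t0 by (simp add: s_def p_def not_le)
        have "v \<mu> \<le> pi / real \<mu>" using r \<mu>1 by (simp add: v_def field_simps)
        then have "w t / t \<le> w (pi / real \<mu>) / v (\<mu> + 1)"
          using sv ts w(2) r by (intro frac_le monoD[OF w(1)]) (auto simp: v_def)
        then show ?thesis by (simp add: v_def mult_ac add.commute)
      qed
      have "w t * \<bar>cos_mean a t\<bar> / t = w t / t * \<bar>cos_mean a t\<bar>" by simp
      also have "\<dots> \<le> c \<mu>"
        unfolding c_def using w_le cos_le w(2) t0 by (intro mult_mono) auto
      also have "c \<mu> \<le> c \<mu> * ring l \<mu> t"
      proof -
        have "1 \<le> ring l \<mu> t"
          using sv unfolding ring_def s_def by (cases "p l \<le> t") (auto simp: indicator_def)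
        then show ?thesis using mult_left_mono[OF _ c_nn, of 1 "ring l \<mu> t" \<mu>] by simp
      qed
      also have "\<dots> \<le> (\<Sum>\<mu> = 1..n. c \<mu> * ring l \<mu> t)"
        by (rule member_le_sum[where f = "\<lambda>\<mu>. c \<mu> * ring l \<mu> t"]) (use \<mu>1 \<mu>n c_nn ring_nn in auto)
      also have "\<dots> \<le> (\<Sum>l\<le>r. \<Sum>\<mu> = 1..n. c \<mu> * ring l \<mu> t)"
        by (rule member_le_sum[where f = "\<lambda>l. \<Sum>\<mu> = 1..n. c \<mu> * ring l \<mu> t"])
           (use l_le c_nn ring_nn in \<open>auto intro!: sum_nonneg\<close>)
      finally show ?thesis unfolding S_def using S2_nn[of t] by linarith
    qed
  qed
  have v_mono: "v (\<mu> + 1) \<le> v \<mu>" if "1 \<le> \<mu>" for \<mu>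
    using that r by (simp add: v_def frac_le)
  have int_ind: "integrable lborel (indicator {x<..y} :: real \<Rightarrow> real)"
    "integrable lborel (indicator {x..<y} :: real \<Rightarrow> real)" for x y :: real
    by (cases "x \<le> y"; simp)+
  have int_ring: "integrable lborel (ring l \<mu>)" for l \<mu>
    unfolding ring_def[abs_def] by (intro Bochner_Integration.integrable_add int_ind)
  have ring_integral: "(\<integral>t. ring l \<mu> t \<partial>lborel) = 2 * (v \<mu> - v (\<mu> + 1))" if "1 \<le> \<mu>" for l \<mu>
    unfolding ring_def using v_mono[OF that]
    by (subst Bochner_Integration.integral_add[OF int_ind]) auto
  have int_disc: "integrable lborel (disc l)" for l
    unfolding disc_def by (cases "p l - v (n + 1) \<le> p l + v (n + 1)"; simp)
  have disc_integral: "(\<integral>t. disc l t \<partial>lborel) = 2 * v (n + 1)" for l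
    unfolding disc_def using r by (simp add: v_def)
  have int_S: "integrable lborel S"
    unfolding S_def[abs_def]
    by (intro Bochner_Integration.integrable_add Bochner_Integration.integrable_sum
          integrable_mult_right int_ring int_disc)
  have "(\<integral>t. S t \<partial>lborel)
      = (\<Sum>l\<le>r. \<Sum>\<mu> = 1..n. c \<mu> * (\<integral>t. ring l \<mu> t \<partial>lborel)) + (\<Sum>l = 1..r. c0 * (\<integral>t. disc l t \<partial>lborel))"
    unfolding S_def using int_ring int_disc by simp
  also have "(\<Sum>l\<le>r. \<Sum>\<mu> = 1..n. c \<mu> * (\<integral>t. ring l \<mu> t \<partial>lborel))
      = (\<Sum>l\<le>r. \<Sum>\<mu> = 1..n. 4 * (w (pi / real \<mu>) / real \<mu> * B \<mu>))"
  proof (intro sum.cong refl)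
    fix \<mu> assume "\<mu> \<in> {1..n}"
    then have \<mu>: "1 \<le> \<mu>" by simp
    have diff: "v \<mu> - v (\<mu> + 1) = pi / (real r * real \<mu> * (real \<mu> + 1))"
      using r \<mu> by (simp add: v_def divide_simps) (simp add: algebra_simps)
    show "c \<mu> * (\<integral>t. ring l \<mu> t \<partial>lborel) = 4 * (w (pi / real \<mu>) / real \<mu> * B \<mu>)" for l
      unfolding ring_integral[OF \<mu>] diff c_def using r \<mu> by (simp add: divide_simps)
  qed
  also have "\<dots> = 4 * (real r + 1) * (\<Sum>\<mu> = 1..n. w (pi / real \<mu>) / real \<mu> * B \<mu>)"
    unfolding sum_distrib_left[symmetric] by (simp add: algebra_simps)
  also have "(\<Sum>l = 1..r. c0 * (\<integral>t. disc l t \<partial>lborel)) \<le> 2 * real r * w (pi / (real n + 1))"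
  proof -
    have "w pi \<le> (real n + 1) * w (pi / (real n + 1))"
      using w(3)[of "n + 1" "pi / (real n + 1)"] by (simp add: add.commute)
    then have "w pi / (real n + 1) \<le> w (pi / (real n + 1))" by (simp add: field_simps)
    then have "2 * real r * (w pi / (real n + 1)) \<le> 2 * real r * w (pi / (real n + 1))"
      by (intro mult_left_mono) auto
    then show ?thesis using r by (simp add: disc_integral c0_def v_def mult_ac add.commute)
  qed
  also have "2 * real r * w (pi / (real n + 1)) \<le> 4 * (real r + 1) * w (pi / (real n + 1))"
    by (intro mult_right_mono w(2)) auto
  finally have S_le: "(\<integral>t. S t \<partial>lborel) \<le> 4 * (real r + 1) * abs_rate w a r n"
    unfolding abs_rate_def B_def[symmetric] by (simp add: algebra_simps)
  have "(\<integral>\<^sup>+t\<in>{pi / (real r * (real n + 1))<..<pi}. ennreal (w t * \<bar>cos_mean a t\<bar> / t) \<partial>lborel)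
      \<le> (\<integral>\<^sup>+t. ennreal (S t) \<partial>lborel)"
    by (intro nn_integral_mono) (auto simp: indicator_def intro!: ennreal_leI pointwise)
  also have "\<dots> = ennreal (\<integral>t. S t \<partial>lborel)"
    by (rule nn_integral_eq_integral[OF int_S]) (use S1_nn S2_nn in \<open>simp add: S_def\<close>)
  also have "\<dots> \<le> ennreal (4 * (real r + 1) * abs_rate w a r n)" by (rule ennreal_leI[OF S_le])
  finally show ?thesis .
qed

section \<open>The deviation as a singular integral\<close>

lemma rate_eq_abs_rate: "rate X f A r n = abs_rate (conj_modulus2 X f) (A n) r n"
proof -
  have "(\<Sum>\<mu> = 1..n. conj_modulus2 X f (pi / real \<mu>) / real \<mu>
           * ((\<Sum>k = 0..\<mu> + 1. A n k) + real \<mu> * r_variation r (A n) \<mu>))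
      = (\<Sum>\<mu> = 1..n. conj_modulus2 X f (pi / real \<mu>) / real \<mu> * (\<Sum>k = 0..\<mu> + 1. A n k)
           + conj_modulus2 X f (pi / real \<mu>) * r_variation r (A n) \<mu>)"
    by (intro sum.cong refl) (simp add: distrib_left)
  then show ?thesis
    by (simp add: rate_def abs_rate_def r_variation_def sum.distrib)
qed

lemma conj_kernel_eq_cos_mean:
  assumes a: "\<And>k. 0 \<le> a k" "a sums 1" and t: "d \<le> t" "0 < t" "t < pi"
  shows "conj_kernel a d t = cos_mean a t / (2 * pi * sin (t / 2))"
proof -
  have sm: "summable a" "suminf a = 1" using a(2) by (auto simp: sums_iff)
  have s: "0 < sin (t / 2)" using t by (intro sin_gt_zero) auto
  have "(\<lambda>k. a k * (1 / 2 * cot (t / 2)) - a k * cos ((real k + 1 / 2) * t) / (2 * sin (t / 2)))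
      sums (1 * (1 / 2 * cot (t / 2)) - cos_mean a t / (2 * sin (t / 2)))"
    unfolding cos_mean_def
    by (intro sums_diff sums_divide sums_mult2 a(2) summable_sums summable_cos_mean[OF a(1) sm(1)])
  then have "(\<Sum>k. a k * conj_dirichlet k t) = 1 / 2 * cot (t / 2) - cos_mean a t / (2 * sin (t / 2))"
    using t by (simp add: conj_dirichlet_eq_cot right_diff_distrib sums_iff)
  then show ?thesis using t by (simp add: conj_kernel_def)
qed

lemma abs_conj_kernel_le:
  assumes a: "\<And>k. 0 \<le> a k" "a sums 1" and t: "d \<le> t" "0 < t" "t < pi"
  shows "\<bar>conj_kernel a d t\<bar> \<le> \<bar>cos_mean a t\<bar> / t"
proof -
  have s: "t / pi \<le> sin (t / 2)" "0 < t / pi" using sin_half_ge[of t] t by auto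
  then have "t \<le> 2 * pi * sin (t / 2)" using t by (simp add: field_simps)
  then have "\<bar>cos_mean a t\<bar> / (2 * pi * sin (t / 2)) \<le> \<bar>cos_mean a t\<bar> / t"
    using s t by (intro divide_left_mono) auto
  then show ?thesis
    using s unfolding conj_kernel_eq_cos_mean[OF assms] by (simp add: abs_mult)
qed

text \<open>The kernel of order \<open>k\<close> is bounded by \<open>k\<close>, so the first moment of \<open>a\<close> bounds the mean of the
  kernels uniformly in \<open>t\<close>.\<close>

lemma moment_series:
  assumes a: "\<And>k. 0 \<le> a k" and m: "summable (\<lambda>k. (real k + 1) * a k)"
  shows "summable (\<lambda>k. a k * \<bar>conj_dirichlet k t\<bar>)"
    and "(\<Sum>k<N. a k * \<bar>conj_dirichlet k t\<bar>) \<le> (\<Sum>k. (real k + 1) * a k)"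
    and "\<bar>\<Sum>k. a k * conj_dirichlet k t\<bar> \<le> (\<Sum>k. (real k + 1) * a k)"
proof -
  have le: "a k * \<bar>conj_dirichlet k t\<bar> \<le> (real k + 1) * a k" for k
    using mult_left_mono[OF abs_conj_dirichlet_le[of k t] a[of k]] a[of k] by (simp add: algebra_simps)
  show 1: "summable (\<lambda>k. a k * \<bar>conj_dirichlet k t\<bar>)"
    by (rule summable_comparison_test'[OF m]) (use le a in \<open>simp add: abs_mult\<close>)
  show "(\<Sum>k<N. a k * \<bar>conj_dirichlet k t\<bar>) \<le> (\<Sum>k. (real k + 1) * a k)"
    using sum_le_suminf[OF 1, of "{..<N}"] suminf_le[OF le 1 m] a by simp
  have "\<bar>\<Sum>k. a k * conj_dirichlet k t\<bar> \<le> (\<Sum>k. \<bar>a k * conj_dirichlet k t\<bar>)"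
    by (rule summable_rabs) (use 1 a in \<open>simp add: abs_mult\<close>)
  also have "\<dots> = (\<Sum>k. a k * \<bar>conj_dirichlet k t\<bar>)" using a by (simp add: abs_mult)
  also have "\<dots> \<le> (\<Sum>k. (real k + 1) * a k)" by (rule suminf_le[OF le 1 m])
  finally show "\<bar>\<Sum>k. a k * conj_dirichlet k t\<bar> \<le> (\<Sum>k. (real k + 1) * a k)" .
qed

lemma bounded_in_cmult:
  assumes "bounded_in X h c" "0 \<le> c" and [measurable]: "h \<in> borel_measurable borel"
  shows "bounded_in X (\<lambda>x. h x * k) (c * \<bar>k\<bar>)"
proof (cases X)
  case (Lp p)
  have "(\<integral>\<^sup>+x. ennreal (\<bar>h x * k\<bar> powr p) \<partial>torus)
      = ennreal (\<bar>k\<bar> powr p) * (\<integral>\<^sup>+x. ennreal (\<bar>h x\<bar> powr p) \<partial>torus)"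
    by (subst nn_integral_cmult[symmetric])
       (auto simp: abs_mult powr_mult ennreal_mult[symmetric] mult.commute intro!: nn_integral_cong)
  also have "\<dots> \<le> ennreal (\<bar>k\<bar> powr p) * ennreal (c powr p)"
    using assms Lp by (intro mult_left_mono) auto
  also have "\<dots> = ennreal ((c * \<bar>k\<bar>) powr p)"
    using assms by (simp add: powr_mult ennreal_mult[symmetric] mult.commute)
  finally show ?thesis by (simp add: Lp)
next
  case Linf
  then show ?thesis using assms(1)
    by (auto simp: abs_mult mult_right_mono elim!: eventually_mono)
next
  case Cont
  then show ?thesis using assms(1) by (auto simp: abs_mult mult_right_mono)
qed

lemma conj_mean_periodic: "conj_mean A n f (x + 2 * pi) = conj_mean A n f x"
proof -
  have "sin (real \<nu> * (x + 2 * pi)) = sin (real \<nu> * x)" "cos (real \<nu> * (x + 2 * pi)) = cos (real \<nu> * x)" for \<nu>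
    using sin.plus_of_nat[of "real \<nu> * x" \<nu>] cos.plus_of_nat[of "real \<nu> * x" \<nu>]
    by (simp_all add: algebra_simps)
  then show ?thesis by (simp add: conj_mean_def conj_partial_sum_def)
qed

context
  fixes X :: fun_space and f :: "real \<Rightarrow> real"
  assumes X: "valid_space X" and borel_f [measurable]: "f \<in> borel_measurable borel"
    and f: "in_space X f"
begin

lemma f_periodic: "f (x + 2 * pi) = f x"
  using f by (cases X) auto

lemma f_integrable: "integrable torus f"
  by (rule in_space_integrable[OF X borel_f f])

lemma psi_pair_measurable [measurable]: "(\<lambda>(x, t). psi f x t) \<in> borel_measurable (borel \<Otimes>\<^sub>M borel)"
  unfolding psi_def by measurable

lemma modulus_measurable [measurable]: "conj_modulus2 X f \<in> borel_measurable borel"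
  by (rule borel_measurable_mono[OF modulus_mono[OF X borel_f f]])

text \<open>Since \<open>psi f _ t\<close> has norm at most \<open>conj_modulus2 X f t\<close>, integrating it against a kernel costs
  at most the integral of the modulus against the absolute value of the kernel.  For continuous \<open>f\<close>
  the same majorant gives the continuity of the result by dominated convergence.\<close>

lemma psi_kernel_bound:
  assumes [measurable]: "k \<in> borel_measurable borel"
    and supp: "\<And>t. \<not> (0 < t \<and> t < pi) \<Longrightarrow> k t = 0"
    and bound: "(\<integral>\<^sup>+t. ennreal (conj_modulus2 X f t * \<bar>k t\<bar>) \<partial>lborel) \<le> ennreal C" and "0 \<le> C"
  shows psi_kernel_integrable: "pointwise_in X (\<lambda>x. integrable lborel (\<lambda>t. psi f x t * k t))"
    and psi_kernel_norm: "pointwise_in X (\<lambda>x. (\<integral>t. psi f x t * k t \<partial>lborel) = h x) \<Longrightarrow>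
      (\<And>x. h (x + 2 * pi) = h x) \<Longrightarrow> in_space X h \<and> norm_space X h \<le> C"
proof -
  define w where "w t = conj_modulus2 X f t * \<bar>k t\<bar>" for t
  note nonneg = modulus_nonneg[OF X borel_f f]
  have w_nn: "0 \<le> w t" for t unfolding w_def using nonneg by simp
  have w: "integrable lborel w"
    using bound w_nn unfolding w_def[abs_def] by (intro integrableI_nonneg) (auto intro: le_less_trans)
  have "ennreal (\<integral>t. w t \<partial>lborel) \<le> ennreal C"
    using bound[folded w_def] nn_integral_eq_integral[OF w] w_nn by simp
  then have w_le: "(\<integral>t. w t \<partial>lborel) \<le> C" using \<open>0 \<le> C\<close> by simp
  have meas: "(\<lambda>(x, t). psi f x t * k t) \<in> borel_measurable (borel \<Otimes>\<^sub>M lborel)"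
    unfolding psi_def by measurable
  have row: "bounded_in X (\<lambda>x. psi f x t * k t) (w t)" for t
  proof (cases "0 < t \<and> t < pi")
    case True
    then show ?thesis unfolding w_def
      by (intro bounded_in_cmult psi_bounded_in_modulus[OF X borel_f f] nonneg) auto
  next
    case False
    then show ?thesis using supp[of t] by (cases X) (auto simp: w_def)
  qed
  note mink = bounded_in_integral[OF X sigma_finite_lborel meas w w_nn AE_I2[OF row]]
  show "pointwise_in X (\<lambda>x. integrable lborel (\<lambda>t. psi f x t * k t))"
    using mink(2) psi_periodic[OF X borel_f f] by simp
  assume eq: "pointwise_in X (\<lambda>x. (\<integral>t. psi f x t * k t \<partial>lborel) = h x)"
    and per: "\<And>x. h (x + 2 * pi) = h x"
  show "in_space X h \<and> norm_space X h \<le> C"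
  proof (rule norm_space_le_bound[OF X _ eq _ \<open>0 \<le> C\<close> per])
    show "(\<lambda>x. \<integral>t. psi f x t * k t \<partial>lborel) \<in> borel_measurable borel"
      by (rule lborel.borel_measurable_lebesgue_integral[OF meas])
    show "bounded_in X (\<lambda>x. \<integral>t. psi f x t * k t \<partial>lborel) C"
      by (rule bounded_in_mono[OF mink(1) _ w_le X]) (use w_nn in simp)
    show "continuous_on UNIV h" if "X = Cont"
    proof (clarsimp simp: continuous_on_eq_continuous_at continuous_at_sequentially)
      fix u :: "nat \<Rightarrow> real" and x assume u: "u \<longlonglongrightarrow> x"
      have h: "h = (\<lambda>x. \<integral>t. psi f x t * k t \<partial>lborel)" using eq that by auto
      have cont: "isCont f y" for y
        using f that by (simp add: continuous_on_eq_continuous_at)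
      show "(h \<circ> u) \<longlonglongrightarrow> h x"
        unfolding h o_def
      proof (rule integral_dominated_convergence[OF _ _ w])
        show "AE t in lborel. (\<lambda>i. psi f (u i) t * k t) \<longlonglongrightarrow> psi f x t * k t"
          unfolding psi_def
          by (intro AE_I2 tendsto_intros isCont_tendsto_compose[OF cont] u)
        show "AE t in lborel. norm (psi f (u i) t * k t) \<le> w t" for i
          using row that by (intro AE_I2) simp
      qed measurable
    qed
  qed
qed

lemma first_term_le_rate:
  assumes "\<And>k. 0 \<le> A n k" "A n sums 1" "0 < r"
  shows "conj_modulus2 X f (pi / (real r * (real n + 1))) \<le> rate X f A r n"
proof -
  have "pi / (real r * (real n + 1)) \<le> pi / (real n + 1)"
    using assms(3) by (intro divide_left_mono) auto
  then have "conj_modulus2 X f (pi / (real r * (real n + 1))) \<le> conj_modulus2 X f (pi / (real n + 1))"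
    by (rule monoD[OF modulus_mono[OF X borel_f f]])
  also have "\<dots> \<le> rate X f A r n"
  proof -
    have "summable (A n)" using assms by (simp add: sums_iff)
    note v_nn = r_variation_nonneg[where a = "A n", OF assms(1) this]
    have "0 \<le> (\<Sum>\<mu> = 1..n. conj_modulus2 X f (pi / real \<mu>) / real \<mu>
        * ((\<Sum>k = 0..\<mu> + 1. A n k) + real \<mu> * r_variation r (A n) \<mu>))"
      by (intro sum_nonneg mult_nonneg_nonneg divide_nonneg_nonneg add_nonneg_nonneg v_nn
          modulus_nonneg[OF X borel_f f] assms(1)) auto
    then show ?thesis unfolding rate_eq_abs_rate abs_rate_def by linarith
  qed
  finally show ?thesis .
qed

text \<open>Both parts of the theorem meet here: only the bound on \<open>(0, \<pi> / (r(n + 1)))\<close> depends on their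
  hypotheses.\<close>

lemma modulus_kernel_integral_le:
  assumes a: "\<And>k. 0 \<le> A n k" "A n sums 1" and r: "0 < r"
    and d: "d \<le> pi / (real r * (real n + 1))"
    and near: "(\<integral>\<^sup>+t\<in>{0<..<pi / (real r * (real n + 1))}.
      ennreal (conj_modulus2 X f t * \<bar>conj_kernel (A n) d t\<bar>) \<partial>lborel) \<le> ennreal (B * rate X f A r n)"
      and B: "0 \<le> B"
  shows "(\<integral>\<^sup>+t. ennreal (conj_modulus2 X f t * \<bar>conj_kernel (A n) d t\<bar>) \<partial>lborel)
    \<le> ennreal ((B + 4 * (real r + 1)) * rate X f A r n)"
proof -
  let ?e = "pi / (real r * (real n + 1))"
  let ?w = "conj_modulus2 X f"
  note nonneg = modulus_nonneg[OF X borel_f f]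
  have rate_nn: "0 \<le> rate X f A r n"
    using first_term_le_rate[of A n r, OF a r] nonneg[of ?e] by linarith
  have e0: "0 < ?e" using r by simp
  have "(\<integral>\<^sup>+t. ennreal (?w t * \<bar>conj_kernel (A n) d t\<bar>) \<partial>lborel)
      \<le> (\<integral>\<^sup>+t. ennreal (?w t * \<bar>conj_kernel (A n) d t\<bar>) * indicator {0<..<?e} t
          + ennreal (?w t * \<bar>cos_mean (A n) t\<bar> / t) * indicator {?e<..<pi} t \<partial>lborel)"
  proof (rule nn_integral_mono_AE, use AE_lborel_singleton[of ?e] in eventually_elim)
    fix t assume "t \<noteq> ?e"
    then consider "t \<le> 0 \<or> pi \<le> t" | "0 < t" "t < ?e" | "?e < t" "t < pi" by linarith
    then show "ennreal (?w t * \<bar>conj_kernel (A n) d t\<bar>)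
      \<le> ennreal (?w t * \<bar>conj_kernel (A n) d t\<bar>) * indicator {0<..<?e} t
          + ennreal (?w t * \<bar>cos_mean (A n) t\<bar> / t) * indicator {?e<..<pi} t"
    proof cases
      case 1 then show ?thesis by (auto simp: conj_kernel_def)
    next
      case 2 then show ?thesis by simp
    next
      case 3
      have "?w t * \<bar>conj_kernel (A n) d t\<bar> \<le> ?w t * (\<bar>cos_mean (A n) t\<bar> / t)"
        by (intro mult_left_mono abs_conj_kernel_le a nonneg) (use 3 d e0 in linarith)+
      then show ?thesis using 3 by (auto intro!: ennreal_leI)
    qed
  qed
  also have "\<dots> = (\<integral>\<^sup>+t\<in>{0<..<?e}. ennreal (?w t * \<bar>conj_kernel (A n) d t\<bar>) \<partial>lborel)
      + (\<integral>\<^sup>+t\<in>{?e<..<pi}. ennreal (?w t * \<bar>cos_mean (A n) t\<bar> / t) \<partial>lborel)"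
    by (rule nn_integral_add) measurable
  also have "\<dots> \<le> ennreal (B * rate X f A r n) + ennreal (4 * (real r + 1) * rate X f A r n)"
    unfolding rate_eq_abs_rate
    by (intro add_mono near[unfolded rate_eq_abs_rate] cos_mean_integral_le modulus_mono[OF X borel_f f]
        nonneg modulus_multiple[OF X borel_f f] a r)
  also have "\<dots> = ennreal ((B + 4 * (real r + 1)) * rate X f A r n)"
    using rate_nn B by (simp add: ennreal_plus[symmetric] distrib_right del: ennreal_plus)
  finally show ?thesis .
qed

text \<open>Below the truncation point the kernel is the mean of the conjugate Dirichlet kernels, of size
  \<open>O(n)\<close> by the moment condition, on an interval of length \<open>O(1 / n)\<close>, so
  that this part contributes no more than a multiple of the modulus at its right end point.\<close>

lemma truncated_deviation:
  assumes A: "\<And>n k. 0 \<le> A n k" "\<And>n. A n sums 1" and r: "0 < r"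
    and mom: "\<And>n. summable (\<lambda>k. (real k + 1) * A n k)"
      "\<And>n. (\<Sum>k. (real k + 1) * A n k) \<le> K * (real n + 1)"
  shows "conj_mean_converges A n f x"
    and "in_space X (\<lambda>x. conj_mean A n f x - conj_trunc f x (pi / (real r * (real n + 1)))) \<and>
      norm_space X (\<lambda>x. conj_mean A n f x - conj_trunc f x (pi / (real r * (real n + 1))))
        \<le> (K + 4 * (real r + 1)) * rate X f A r n"
proof -
  let ?e = "pi / (real r * (real n + 1))"
  let ?M = "\<Sum>k. (real k + 1) * A n k"
  let ?w = "conj_modulus2 X f"
  note nonneg = modulus_nonneg[OF X borel_f f]
  note L1 = borel_f f_periodic f_integrable
  have e0: "0 < ?e" using r by simp
  have M_nn: "0 \<le> ?M" using A mom by (intro suminf_nonneg) auto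
  then have "0 \<le> K * (real n + 1)" using mom(2)[of n] by linarith
  then have K: "0 \<le> K" by (simp add: zero_le_mult_iff)
  have rate_nn: "0 \<le> rate X f A r n"
    using first_term_le_rate[of A n r, OF A(1) A(2) r] nonneg[of ?e] by linarith
  have sums: "(\<lambda>k. A n k * conj_partial_sum k f x) sums
      (- (1 / pi) * (\<integral>t. half t * (psi f x t * (\<Sum>k. A n k * conj_dirichlet k t)) \<partial>lborel))" for x
  proof (rule conj_mean_sums_integral[OF L1 A(1)])
    show "(\<Sum>k<N. A n k * \<bar>conj_dirichlet k t\<bar>) \<le> ?M" for t N
      by (rule moment_series(2)[OF A(1) mom(1)])
    have "integrable lborel (\<lambda>t. \<bar>half t * psi f x t\<bar> * ?M)"
      using integrable_half_psi[OF L1, of x] by simp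
    then show "integrable lborel (\<lambda>t. half t * (\<bar>psi f x t\<bar> * ?M))"
      by (simp add: abs_mult mult.assoc)
  qed
  then show "conj_mean_converges A n f x"
    by (auto simp: conj_mean_converges_def sums_iff)
  have eq: "(\<integral>t. psi f x t * conj_kernel (A n) ?e t \<partial>lborel) = conj_mean A n f x - conj_trunc f x ?e" for x
  proof -
    have 1: "integrable lborel (\<lambda>t. half t * (psi f x t * (\<Sum>k. A n k * conj_dirichlet k t)))"
      by (rule integrable_half_psi_bounded[OF L1]) (use moment_series(3)[OF A(1) mom(1)] in auto)
    have 2: "integrable lborel (\<lambda>t. half t * (psi f x t * (indicator {?e..} t * (1 / 2 * cot (t / 2)))))"
    proof (rule integrable_half_psi_bounded[OF L1])
      fix t assume t: "0 < t" "t < pi"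
      show "\<bar>indicator {?e..} t * (1 / 2 * cot (t / 2))\<bar> \<le> pi / (2 * ?e)"
      proof (cases "?e \<le> t")
        case True
        have "\<bar>1 / 2 * cot (t / 2)\<bar> \<le> pi / (2 * t)" by (rule abs_half_cot_le[OF t])
        also have "\<dots> \<le> pi / (2 * ?e)" using True e0 t by (intro divide_left_mono mult_pos_pos mult_left_mono) auto
        finally show ?thesis using True by simp
      next
        case False
        then show ?thesis using r by simp
      qed
    qed measurable
    have "(\<integral>t. psi f x t * conj_kernel (A n) ?e t \<partial>lborel)
      = (\<integral>t. 1 / pi * (half t * (psi f x t * (indicator {?e..} t * (1 / 2 * cot (t / 2)))))
          - 1 / pi * (half t * (psi f x t * (\<Sum>k. A n k * conj_dirichlet k t))) \<partial>lborel)"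
      unfolding conj_kernel_def by (intro Bochner_Integration.integral_cong refl) (simp add: algebra_simps)
    also have "\<dots> = 1 / pi * (\<integral>t. half t * (psi f x t * (indicator {?e..} t * (1 / 2 * cot (t / 2)))) \<partial>lborel)
          - 1 / pi * (\<integral>t. half t * (psi f x t * (\<Sum>k. A n k * conj_dirichlet k t)) \<partial>lborel)"
      using 1 2 by (subst Bochner_Integration.integral_diff) (simp_all only: integrable_mult_right integral_mult_right_zero)
    also have "\<dots> = conj_mean A n f x - conj_trunc f x ?e"
      using sums[of x] unfolding conj_trunc_eq_integral[OF L1 e0] conj_mean_def by (simp add: sums_iff)
    finally show ?thesis .
  qed
  have trunc_per: "conj_trunc f (x + 2 * pi) d = conj_trunc f x d" for x d
    by (simp add: conj_trunc_def psi_periodic[OF X borel_f f])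
  have near: "(\<integral>\<^sup>+t\<in>{0<..<?e}. ennreal (?w t * \<bar>conj_kernel (A n) ?e t\<bar>) \<partial>lborel)
      \<le> ennreal (K * rate X f A r n)"
  proof -
    have "(\<integral>\<^sup>+t\<in>{0<..<?e}. ennreal (?w t * \<bar>conj_kernel (A n) ?e t\<bar>) \<partial>lborel)
        \<le> (\<integral>\<^sup>+t. ennreal (?w ?e * (1 / pi * ?M)) * indicator {0<..<?e} t \<partial>lborel)"
    proof (intro nn_integral_mono)
      fix t
      show "ennreal (?w t * \<bar>conj_kernel (A n) ?e t\<bar>) * indicator {0<..<?e} t
        \<le> ennreal (?w ?e * (1 / pi * ?M)) * indicator {0<..<?e} t"
      proof (cases "0 < t \<and> t < ?e")
        case True
        have "\<bar>conj_kernel (A n) ?e t\<bar> \<le> 1 / pi * ?M"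
          using moment_series(3)[OF A(1) mom(1), of n t] True M_nn
          by (auto simp: conj_kernel_def abs_mult indicator_def divide_right_mono)
        then have "?w t * \<bar>conj_kernel (A n) ?e t\<bar> \<le> ?w ?e * (1 / pi * ?M)"
          using True by (intro mult_mono monoD[OF modulus_mono[OF X borel_f f]] nonneg) auto
        then show ?thesis using True by (simp add: ennreal_leI)
      qed simp
    qed
    also have "\<dots> = ennreal (?w ?e * (1 / pi * ?M)) * ennreal ?e"
      using e0 by (subst nn_integral_cmult_indicator) auto
    also have "\<dots> = ennreal (?w ?e * (1 / pi * ?M) * ?e)"
      using nonneg[of ?e] M_nn e0 by (subst ennreal_mult) auto
    also have "\<dots> \<le> ennreal (K * rate X f A r n)"
    proof (rule ennreal_leI)
      have "1 / pi * ?M * ?e \<le> 1 / pi * (K * (real n + 1)) * ?e"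
        using mom(2)[of n] e0 by (intro mult_right_mono mult_left_mono) auto
      also have "\<dots> = K / real r" using r by (simp add: divide_simps)
      also have "\<dots> \<le> K" using K r by (simp add: divide_le_eq mult_le_cancel_left1)
      finally have "?w ?e * (1 / pi * ?M * ?e) \<le> ?w ?e * K"
        by (rule mult_left_mono[OF _ nonneg])
      also have "\<dots> \<le> rate X f A r n * K"
        by (rule mult_right_mono[OF first_term_le_rate[of A n r, OF A(1) A(2) r] K])
      finally show "?w ?e * (1 / pi * ?M) * ?e \<le> K * rate X f A r n" by (simp add: mult_ac)
    qed
    finally show ?thesis .
  qed
  show "in_space X (\<lambda>x. conj_mean A n f x - conj_trunc f x ?e) \<and>
      norm_space X (\<lambda>x. conj_mean A n f x - conj_trunc f x ?e) \<le> (K + 4 * (real r + 1)) * rate X f A r n"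
  proof (rule psi_kernel_norm[where k = "conj_kernel (A n) ?e"])
    show "(\<integral>\<^sup>+t. ennreal (?w t * \<bar>conj_kernel (A n) ?e t\<bar>) \<partial>lborel)
        \<le> ennreal ((K + 4 * (real r + 1)) * rate X f A r n)"
      by (rule modulus_kernel_integral_le[of A n r, OF A(1) A(2) r order_refl near K])
    show "pointwise_in X (\<lambda>x. (\<integral>t. psi f x t * conj_kernel (A n) ?e t \<partial>lborel)
        = conj_mean A n f x - conj_trunc f x ?e)"
      using eq by (cases X) auto
  qed (use K rate_nn conj_mean_periodic trunc_per in \<open>auto simp: conj_kernel_def\<close>)
qed

lemma pointwise_in_mono:
  assumes "pointwise_in X P" "\<And>x. P x \<Longrightarrow> P' x"
  shows "pointwise_in X P'"
  using assms by (cases X) (auto elim: eventually_mono)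

text \<open>The hypothesis bounds \<open>conj_modulus2 X f t / t\<close> in the mean.  With \<open>u = \<pi>\<close>, Minkowski's inequality
  makes \<open>psi f x t / t\<close> integrable for almost every \<open>x\<close> (for every \<open>x\<close> if \<open>f\<close> is continuous): Dini's
  condition, under which the conjugate function exists and the mean converges.  With
  \<open>u = \<pi> / (r(n + 1))\<close> it bounds the contribution of the kernel near the origin, where the kernel is
  at most \<open>1 / t\<close>.\<close>

lemma conj_fun_deviation:
  assumes A: "\<And>n k. 0 \<le> A n k" "\<And>n. A n sums 1" and r: "0 < r"
    and dini: "\<forall>u\<in>{0..2 * pi}. (\<integral>\<^sup>+t\<in>{0..u}. ennreal (conj_modulus2 X f t / t) \<partial>lborel)
            \<le> ennreal (K * conj_modulus2 X f u)" and K: "0 \<le> K"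
  shows "pointwise_in X (conj_fun_exists f)"
    and "pointwise_in X (conj_mean_converges A n f)"
    and "in_space X (\<lambda>x. conj_mean A n f x - conj_fun f x) \<and>
      norm_space X (\<lambda>x. conj_mean A n f x - conj_fun f x) \<le> (K + 4 * (real r + 1)) * rate X f A r n"
proof -
  let ?w = "conj_modulus2 X f"
  let ?e = "\<lambda>n. pi / (real r * (real n + 1))"
  note nonneg = modulus_nonneg[OF X borel_f f]
  note L1 = borel_f f_periodic f_integrable
  note [measurable] = psi_measurable[OF L1]
  have e0: "0 < ?e n" for n using r by simp
  have rate_nn: "0 \<le> rate X f A r n" for n
    using first_term_le_rate[of A n r, OF A(1) A(2) r] nonneg[of "?e n"] by linarith
  have good: "pointwise_in X (\<lambda>x. integrable lborel (\<lambda>t. psi f x t * (half t * (1 / t))))"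
  proof (rule psi_kernel_integrable[where C = "K * ?w pi"])
    have "(\<integral>\<^sup>+t. ennreal (?w t * \<bar>half t * (1 / t)\<bar>) \<partial>lborel)
        \<le> (\<integral>\<^sup>+t\<in>{0..pi}. ennreal (?w t / t) \<partial>lborel)"
      by (intro nn_integral_mono) (auto simp: indicator_def)
    also have "\<dots> \<le> ennreal (K * ?w pi)" by (rule bspec[OF dini]) simp
    finally show "(\<integral>\<^sup>+t. ennreal (?w t * \<bar>half t * (1 / t)\<bar>) \<partial>lborel) \<le> ennreal (K * ?w pi)" .
  qed (use K nonneg in \<open>auto simp: indicator_def\<close>)
  have main: "conj_fun_exists f x \<and> conj_mean_converges A n f x \<and>
      (\<integral>t. psi f x t * conj_kernel (A n) 0 t \<partial>lborel) = conj_mean A n f x - conj_fun f x"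
    if int: "integrable lborel (\<lambda>t. psi f x t * (half t * (1 / t)))" for x n
  proof -
    have dom: "integrable lborel (\<lambda>t. half t * (\<bar>psi f x t\<bar> * (pi / t)))"
    proof -
      have "integrable lborel (\<lambda>t. pi * \<bar>psi f x t * (half t * (1 / t))\<bar>)"
        by (rule integrable_mult_right[OF integrable_abs[OF int]])
      then show ?thesis
        by (rule Bochner_Integration.integrable_cong[THEN iffD1, rotated -1])
           (auto simp: abs_mult indicator_def)
    qed
    have cot_dom: "\<bar>half t * (psi f x t * (i * (1 / 2 * cot (t / 2))))\<bar>
        \<le> half t * (\<bar>psi f x t\<bar> * (pi / t))" if "\<bar>i\<bar> \<le> 1" for i t
    proof (cases "0 < t \<and> t < pi")
      case True
      have "\<bar>i * (1 / 2 * cot (t / 2))\<bar> \<le> 1 * (pi / (2 * t))"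
        unfolding abs_mult[of i] by (intro mult_mono abs_half_cot_le that) (use True in auto)
      also have "\<dots> \<le> pi / t" using True by (simp add: divide_left_mono)
      finally have "\<bar>psi f x t\<bar> * \<bar>i * (1 / 2 * cot (t / 2))\<bar> \<le> \<bar>psi f x t\<bar> * (pi / t)"
        by (rule mult_left_mono) simp
      then show ?thesis using True by (simp add: abs_mult)
    qed simp
    have cot_int: "integrable lborel (\<lambda>t. half t * (psi f x t * (1 / 2 * cot (t / 2))))"
    proof (rule Bochner_Integration.integrable_bound[OF dom])
      have le: "\<bar>half t * (psi f x t * (1 / 2 * cot (t / 2)))\<bar> \<le> half t * (\<bar>psi f x t\<bar> * (pi / t))" for t
        using cot_dom[of 1 t] by simp
      show "AE t in lborel. norm (half t * (psi f x t * (1 / 2 * cot (t / 2))))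
          \<le> norm (half t * (\<bar>psi f x t\<bar> * (pi / t)))"
        unfolding real_norm_def by (intro AE_I2 order_trans[OF le abs_ge_self])
    qed measurable
    define L where "L = - (1 / pi) * (\<integral>t. half t * (psi f x t * (1 / 2 * cot (t / 2))) \<partial>lborel)"
    have lim: "((\<lambda>d. conj_trunc f x d) \<longlongrightarrow> L) (at_right 0)"
    proof (subst tendsto_at_iff_sequentially, intro allI impI)
      fix u :: "nat \<Rightarrow> real" assume u: "\<forall>i. u i \<in> {0<..} - {0}" "u \<longlonglongrightarrow> 0"
      have "(\<lambda>i. \<integral>t. half t * (psi f x t * (indicator {u i..} t * (1 / 2 * cot (t / 2)))) \<partial>lborel)
          \<longlonglongrightarrow> (\<integral>t. half t * (psi f x t * (1 / 2 * cot (t / 2))) \<partial>lborel)"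
      proof (rule integral_dominated_convergence[OF _ _ dom])
        show "AE t in lborel. (\<lambda>i. half t * (psi f x t * (indicator {u i..} t * (1 / 2 * cot (t / 2)))))
            \<longlonglongrightarrow> half t * (psi f x t * (1 / 2 * cot (t / 2)))"
        proof (rule AE_I2)
          fix t
          show "(\<lambda>i. half t * (psi f x t * (indicator {u i..} t * (1 / 2 * cot (t / 2)))))
            \<longlonglongrightarrow> half t * (psi f x t * (1 / 2 * cot (t / 2)))"
          proof (cases "0 < t")
            case True
            have "\<forall>\<^sub>F i in sequentially. u i < t" using order_tendstoD(2)[OF u(2) True] .
            then have "\<forall>\<^sub>F i in sequentially. half t * (psi f x t * (indicator {u i..} t * (1 / 2 * cot (t / 2))))
                = half t * (psi f x t * (1 / 2 * cot (t / 2)))"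
              by eventually_elim simp
            then show ?thesis by (rule tendsto_eventually)
          qed simp
        qed
        show "AE t in lborel. norm (half t * (psi f x t * (indicator {u i..} t * (1 / 2 * cot (t / 2)))))
            \<le> half t * (\<bar>psi f x t\<bar> * (pi / t))" for i
          using cot_dom by (intro AE_I2) (simp add: indicator_def)
      qed measurable
      then show "((\<lambda>d. conj_trunc f x d) \<circ> u) \<longlonglongrightarrow> L"
        unfolding L_def o_def using u(1) tendsto_mult_left[of _ _ _ "- (1 / pi)"]
        by (simp only: conj_trunc_eq_integral[OF L1] greaterThan_iff Diff_iff)
    qed
    then have ex: "conj_fun_exists f x" by (auto simp: conj_fun_exists_def)
    have fun_eq: "conj_fun f x = L"
      unfolding conj_fun_def by (rule tendsto_Lim[OF _ lim]) simp
    have partial: "(\<Sum>k<N. A n k * \<bar>conj_dirichlet k t\<bar>) \<le> pi / t" if t: "0 < t" "t < pi" for t N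
    proof -
      have "(\<Sum>k<N. A n k * \<bar>conj_dirichlet k t\<bar>) \<le> (\<Sum>k<N. A n k * (pi / t))"
        by (intro sum_mono mult_left_mono abs_conj_dirichlet_le_inverse t A)
      also have "\<dots> = (\<Sum>k<N. A n k) * (pi / t)" by (rule sum_distrib_right[symmetric])
      also have "\<dots> \<le> 1 * (pi / t)"
        using sum_le_suminf[of "A n" "{..<N}"] A[of n] t
        by (intro mult_right_mono) (auto simp: sums_iff)
      finally show ?thesis by simp
    qed
    have sums: "(\<lambda>k. A n k * conj_partial_sum k f x) sums
        (- (1 / pi) * (\<integral>t. half t * (psi f x t * (\<Sum>k. A n k * conj_dirichlet k t)) \<partial>lborel))"
      by (rule conj_mean_sums_integral[OF L1 A(1) partial dom])
    have series_int: "integrable lborel (\<lambda>t. half t * (psi f x t * (\<Sum>k. A n k * conj_dirichlet k t)))"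
    proof (rule Bochner_Integration.integrable_bound[OF dom])
      have le: "\<bar>half t * (psi f x t * (\<Sum>k. A n k * conj_dirichlet k t))\<bar>
          \<le> half t * (\<bar>psi f x t\<bar> * (pi / t))" for t
      proof (cases "0 < t \<and> t < pi")
        case True
        have s: "summable (\<lambda>k. \<bar>A n k * conj_dirichlet k t\<bar>)"
        proof (rule bounded_imp_summable)
          show "(\<Sum>k\<le>N. \<bar>A n k * conj_dirichlet k t\<bar>) \<le> pi / t" for N
            using partial[of t "Suc N"] True A by (simp add: abs_mult lessThan_Suc_atMost)
        qed simp
        have "\<bar>\<Sum>k. A n k * conj_dirichlet k t\<bar> \<le> (\<Sum>k. \<bar>A n k * conj_dirichlet k t\<bar>)"
          by (rule summable_rabs[OF s])
        also have "\<dots> \<le> pi / t"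
          by (rule suminf_le_const[OF s]) (use partial[of t] True A in \<open>simp add: abs_mult\<close>)
        finally have "\<bar>psi f x t\<bar> * \<bar>\<Sum>k. A n k * conj_dirichlet k t\<bar> \<le> \<bar>psi f x t\<bar> * (pi / t)"
          by (rule mult_left_mono) simp
        then show ?thesis using True by (simp add: abs_mult)
      qed simp
      show "AE t in lborel. norm (half t * (psi f x t * (\<Sum>k. A n k * conj_dirichlet k t)))
          \<le> norm (half t * (\<bar>psi f x t\<bar> * (pi / t)))"
        unfolding real_norm_def by (intro AE_I2 order_trans[OF le abs_ge_self])
    qed measurable
    have "(\<integral>t. psi f x t * conj_kernel (A n) 0 t \<partial>lborel)
      = (\<integral>t. 1 / pi * (half t * (psi f x t * (1 / 2 * cot (t / 2))))
          - 1 / pi * (half t * (psi f x t * (\<Sum>k. A n k * conj_dirichlet k t))) \<partial>lborel)"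
      unfolding conj_kernel_def
      by (intro Bochner_Integration.integral_cong refl) (auto simp: indicator_def algebra_simps)
    also have "\<dots> = 1 / pi * (\<integral>t. half t * (psi f x t * (1 / 2 * cot (t / 2))) \<partial>lborel)
          - 1 / pi * (\<integral>t. half t * (psi f x t * (\<Sum>k. A n k * conj_dirichlet k t)) \<partial>lborel)"
      using cot_int series_int
      by (subst Bochner_Integration.integral_diff) (simp_all only: integrable_mult_right integral_mult_right_zero)
    also have "\<dots> = conj_mean A n f x - conj_fun f x"
      using sums unfolding fun_eq L_def conj_mean_def by (simp add: sums_iff)
    finally show ?thesis using ex sums by (auto simp: conj_mean_converges_def sums_iff)
  qed
  show "pointwise_in X (conj_fun_exists f)"
    by (rule pointwise_in_mono[OF good], drule main[of _ n], elim conjE)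
  show "pointwise_in X (conj_mean_converges A n f)"
    by (rule pointwise_in_mono[OF good], drule main[of _ n], elim conjE)
  have fun_per: "conj_fun f (x + 2 * pi) = conj_fun f x" for x
    by (simp add: conj_fun_def conj_trunc_def psi_periodic[OF X borel_f f])
  have near: "(\<integral>\<^sup>+t\<in>{0<..<?e n}. ennreal (?w t * \<bar>conj_kernel (A n) 0 t\<bar>) \<partial>lborel)
      \<le> ennreal (K * rate X f A r n)"
  proof -
    have "(\<integral>\<^sup>+t\<in>{0<..<?e n}. ennreal (?w t * \<bar>conj_kernel (A n) 0 t\<bar>) \<partial>lborel)
        \<le> (\<integral>\<^sup>+t\<in>{0..?e n}. ennreal (?w t / t) \<partial>lborel)"
    proof (intro nn_integral_mono)
      fix t
      show "ennreal (?w t * \<bar>conj_kernel (A n) 0 t\<bar>) * indicator {0<..<?e n} t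
          \<le> ennreal (?w t / t) * indicator {0..?e n} t"
      proof (cases "0 < t \<and> t < ?e n")
        case True
        have "?e n \<le> pi"
          using r by (simp add: divide_le_eq mult_ge1_I)
        then have "\<bar>conj_kernel (A n) 0 t\<bar> \<le> \<bar>cos_mean (A n) t\<bar> / t"
          using True by (intro abs_conj_kernel_le A) auto
        also have "\<dots> \<le> 1 / t"
          using True by (intro divide_right_mono abs_cos_mean_le_1 A) auto
        finally have "?w t * \<bar>conj_kernel (A n) 0 t\<bar> \<le> ?w t * (1 / t)"
          by (rule mult_left_mono[OF _ nonneg])
        then show ?thesis using True by (simp add: ennreal_leI)
      qed simp
    qed
    also have "\<dots> \<le> ennreal (K * ?w (?e n))"
    proof (rule bspec[OF dini])
      have "1 * 1 \<le> real r * (real n + 1)" using r by (intro mult_mono) auto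
      then have "?e n \<le> pi / 1" by (intro divide_left_mono) auto
      then show "?e n \<in> {0..2 * pi}" using e0[of n] by simp
    qed
    also have "\<dots> \<le> ennreal (K * rate X f A r n)"
      by (intro ennreal_leI mult_left_mono first_term_le_rate A r K)
    finally show ?thesis .
  qed
  show "in_space X (\<lambda>x. conj_mean A n f x - conj_fun f x) \<and>
      norm_space X (\<lambda>x. conj_mean A n f x - conj_fun f x) \<le> (K + 4 * (real r + 1)) * rate X f A r n"
  proof (rule psi_kernel_norm[where k = "conj_kernel (A n) 0"])
    show "(\<integral>\<^sup>+t. ennreal (?w t * \<bar>conj_kernel (A n) 0 t\<bar>) \<partial>lborel)
        \<le> ennreal ((K + 4 * (real r + 1)) * rate X f A r n)"
      by (rule modulus_kernel_integral_le[of A n r, OF A(1) A(2) r _ near K]) (use r in simp)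
    show "pointwise_in X (\<lambda>x. (\<integral>t. psi f x t * conj_kernel (A n) 0 t \<partial>lborel)
        = conj_mean A n f x - conj_fun f x)"
      by (rule pointwise_in_mono[OF good], drule main[of _ n], elim conjE)
  qed (use K rate_nn conj_mean_periodic fun_per in \<open>auto simp: conj_kernel_def\<close>)
qed

end

section \<open>Reduction to Borel functions and the theorem\<close>

text \<open>Joint measurability of \<open>(x, t) \<mapsto> f (x + t)\<close>, which Tonelli's theorem needs, holds for Borel
  functions but can fail for Lebesgue measurable ones.  In the Lebesgue spaces all the quantities of
  the theorem ignore null sets, so \<open>f\<close> may be replaced by a periodic Borel function that equals it almost
  everywhere; a continuous \<open>f\<close> is a Borel function already.\<close>

lemma borel_representative:
  assumes X: "valid_space X" and f: "in_space X f"
  obtains g where "g \<in> borel_measurable borel" "in_space X g"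
    "conj_modulus2 X g = conj_modulus2 X f"
    "\<And>k. conj_partial_sum k g = conj_partial_sum k f" "conj_trunc g = conj_trunc f"
proof (cases "X = Cont")
  case True
  then have "f \<in> borel_measurable borel" using f by (simp add: borel_measurable_continuous_onI)
  then show ?thesis using that f by blast
next
  case False
  have per: "f (x + 2 * pi) = f x" for x using f by (cases X) auto
  have mf: "f \<in> borel_measurable (lebesgue_on Q)" using f False by (cases X) auto
  have "(\<lambda>x. indicator Q x *\<^sub>R f x) \<in> borel_measurable lebesgue"
    using mf by (subst (asm) borel_measurable_restrict_space_iff) auto
  from completion_ex_borel_measurable_real[OF this]
  obtain g' where [measurable]: "g' \<in> borel_measurable borel"
    and g': "AE x in lborel. indicator Q x *\<^sub>R f x = g' x" by auto
  have [measurable]: "wrap \<in> borel_measurable borel" unfolding wrap_def[abs_def] by measurable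
  define g where "g x = g' (wrap x)" for x
  have g [measurable]: "g \<in> borel_measurable borel" unfolding g_def[abs_def] by measurable
  have g_per: "g (x + 2 * pi) = g x" for x
    unfolding g_def by (simp add: wrap_periodic)
  have ae: "AE x in lborel. f x = g x"
  proof (rule AE_periodic)
    show "(f (x + 2 * pi) = g (x + 2 * pi)) = (f x = g x)" for x by (simp add: per g_per)
    show "AE x in torus. f x = g x"
      unfolding AE_torus_iff using g' AE_lborel_singleton[of pi]
    proof eventually_elim
      fix x assume "indicator Q x *\<^sub>R f x = g' x" "x \<noteq> pi"
      then show "x \<in> Q \<longrightarrow> f x = g x" by (auto simp: g_def wrap_ident)
    qed
  qed
  have leb: "h \<in> borel_measurable lebesgue"
    if "k \<in> borel_measurable borel" "AE x in lborel. h x = k x" for h k :: "real \<Rightarrow> real"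
    by (rule AE_eq_borel_imp_lebesgue_measurable[OF that(1)])
       (use that(2) in \<open>auto intro!: AE_completion elim: eventually_mono\<close>)
  have meas_on: "h \<in> borel_measurable (lebesgue_on Q)"
    if "k \<in> borel_measurable borel" "AE x in lborel. h x = k x" for h k :: "real \<Rightarrow> real"
    by (rule measurable_lebesgue_on_Q[OF leb[OF that]])
  have AE_on: "AE x in lebesgue_on Q. P x" if "AE x in lborel. P x" for P
    using that by (auto simp: AE_lebesgue_on_Q_iff AE_torus_iff elim: eventually_mono)
  have psi_x: "AE t in lborel. psi f x t = psi g x t" for x
  proof -
    have "AE t in lborel. f (x + 1 * t) = g (x + 1 * t)" "AE t in lborel. f (x + -1 * t) = g (x + -1 * t)"
      by (rule AE_lborel_affine[OF ae]; simp)+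
    then show ?thesis by eventually_elim (simp add: psi_def)
  qed
  have psi_t: "AE x in lborel. psi f x t = psi g x t" for t
  proof -
    have "AE x in lborel. f (t + 1 * x) = g (t + 1 * x)" "AE x in lborel. f (- t + 1 * x) = g (- t + 1 * x)"
      by (rule AE_lborel_affine[OF ae]; simp)+
    then show ?thesis by eventually_elim (simp add: psi_def add.commute)
  qed
  have norm_eq: "norm_space X h = norm_space X k"
    if [measurable]: "k \<in> borel_measurable borel" and hk: "AE x in lborel. h x = k x" for h k
  proof -
    note [measurable] = meas_on[OF that]
    have [measurable]: "k \<in> borel_measurable (lebesgue_on Q)" by (rule meas_on[of k]) auto
    have eq: "AE x in lebesgue_on Q. h x = k x" by (rule AE_on[OF hk])
    show ?thesis
    proof (cases X)
      case (Lp p)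
      have "(LINT x|lebesgue_on Q. \<bar>h x\<bar> powr p) = (LINT x|lebesgue_on Q. \<bar>k x\<bar> powr p)"
        by (rule integral_cong_AE) (use eq in \<open>auto elim: eventually_mono\<close>)
      then show ?thesis by (simp add: Lp)
    next
      case Linf
      have "esssup (lebesgue_on Q) (\<lambda>x. ereal \<bar>h x\<bar>) = esssup (lebesgue_on Q) (\<lambda>x. ereal \<bar>k x\<bar>)"
        by (rule esssup_AE_cong) (use eq in \<open>auto elim: eventually_mono\<close>)
      then show ?thesis by (simp add: Linf)
    qed (use False in simp)
  qed
  have gQ [measurable]: "g \<in> borel_measurable (lebesgue_on Q)" by (rule meas_on[of g]) auto
  note [measurable] = mf
  have eqQ: "AE x in lebesgue_on Q. f x = g x" by (rule AE_on[OF ae])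
  have 1: "in_space X g"
  proof (cases X)
    case (Lp p)
    have "integrable (lebesgue_on Q) (\<lambda>x. \<bar>f x\<bar> powr p) \<longleftrightarrow> integrable (lebesgue_on Q) (\<lambda>x. \<bar>g x\<bar> powr p)"
      by (rule integrable_cong_AE) (use eqQ in \<open>auto elim: eventually_mono\<close>)
    then show ?thesis using f g_per gQ by (simp add: Lp)
  next
    case Linf
    have "esssup (lebesgue_on Q) (\<lambda>x. ereal \<bar>f x\<bar>) = esssup (lebesgue_on Q) (\<lambda>x. ereal \<bar>g x\<bar>)"
      by (rule esssup_AE_cong) (use eqQ in \<open>auto elim: eventually_mono\<close>)
    then show ?thesis using f g_per gQ by (simp add: Linf)
  qed (use False in simp)
  have "norm_space X (\<lambda>x. psi f x t) = norm_space X (\<lambda>x. psi g x t)" for t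
    by (rule norm_eq[OF _ psi_t]) (simp add: psi_def)
  then have 2: "conj_modulus2 X g = conj_modulus2 X f" by (simp add: fun_eq_iff conj_modulus2_def)
  have "(LINT t|lebesgue_on Q. f t * q t) = (LINT t|lebesgue_on Q. g t * q t)"
    if "q \<in> borel_measurable borel" for q
  proof -
    have [measurable]: "q \<in> borel_measurable (lebesgue_on Q)" by (rule meas_on[of q]) (use that in auto)
    show ?thesis by (rule integral_cong_AE) (use eqQ in \<open>auto elim: eventually_mono\<close>)
  qed
  then have 3: "conj_partial_sum k g = conj_partial_sum k f" for k
    by (simp add: fun_eq_iff conj_partial_sum_def fourier_cos_def fourier_sin_def)
  have 4: "conj_trunc g = conj_trunc f"
  proof (intro ext)
    fix x d
    have psi_g: "psi g x \<in> borel_measurable borel" unfolding psi_def[abs_def] by measurable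
    have [measurable]: "psi f x \<in> borel_measurable lebesgue" by (rule leb[OF psi_g psi_x])
    have [measurable]: "psi g x \<in> borel_measurable lebesgue" by (rule leb[OF psi_g]) simp
    have [measurable]: "(\<lambda>t::real. cot (t / 2)) \<in> borel_measurable lebesgue"
      by (rule leb[OF cot_half_measurable]) simp
    have "AE t in lebesgue. psi f x t = psi g x t" by (rule AE_completion[OF psi_x])
    then have "(LINT t:{d..pi}|lebesgue. psi g x t * (1 / 2 * cot (t / 2)))
      = (LINT t:{d..pi}|lebesgue. psi f x t * (1 / 2 * cot (t / 2)))"
      unfolding set_lebesgue_integral_def
    proof (intro integral_cong_AE)
      have [measurable]: "{d..pi} \<in> sets lebesgue" by simp
      show "(\<lambda>t. indicator {d..pi} t *\<^sub>R (psi g x t * (1 / 2 * cot (t / 2)))) \<in> borel_measurable lebesgue"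
        "(\<lambda>t. indicator {d..pi} t *\<^sub>R (psi f x t * (1 / 2 * cot (t / 2)))) \<in> borel_measurable lebesgue"
        by measurable
    qed (auto elim!: eventually_mono)
    then show "conj_trunc g x d = conj_trunc f x d" by (simp add: conj_trunc_def)
  qed
  show ?thesis by (rule that[OF g 1 2 3 4])
qed

theorem theorem4:
  fixes X :: fun_space and f :: "real \<Rightarrow> real" and A :: "nat \<Rightarrow> nat \<Rightarrow> real" and r :: nat
  assumes X_valid: "\<And>p. X = Lp p \<Longrightarrow> 1 \<le> p"
    and f_in: "in_space X f"
    and r_pos: "0 < r"
    and A_nonneg: "\<And>n k. 0 \<le> A n k"
    and A_lim: "\<And>k. (\<lambda>n. A n k) \<longlonglongrightarrow> 0"
    and A_sums: "\<And>n. A n sums 1"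
  shows
    "((\<exists>K. \<forall>u\<in>{0..2 * pi}.
          (\<integral>\<^sup>+t\<in>{0..u}. ennreal (conj_modulus2 X f t / t) \<partial>lborel)
            \<le> ennreal (K * conj_modulus2 X f u))
      \<longrightarrow> (pointwise_in X (conj_fun_exists f) \<and>
           (\<forall>n. pointwise_in X (conj_mean_converges A n f)) \<and>
           (\<exists>K. \<forall>n. in_space X (\<lambda>x. conj_mean A n f x - conj_fun f x) \<and>
              norm_space X (\<lambda>x. conj_mean A n f x - conj_fun f x) \<le> K * rate X f A r n)))
   \<and> ((\<exists>K. \<forall>n. summable (\<lambda>k. (real k + 1) * A n k) \<and>
          (\<Sum>k. (real k + 1) * A n k) \<le> K * (real n + 1))
      \<longrightarrow> ((\<forall>n. pointwise_in X (conj_mean_converges A n f)) \<and>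
           (\<exists>K. \<forall>n.
              in_space X (\<lambda>x. conj_mean A n f x - conj_trunc f x (pi / (real r * (real n + 1)))) \<and>
              norm_space X (\<lambda>x. conj_mean A n f x - conj_trunc f x (pi / (real r * (real n + 1))))
                \<le> K * rate X f A r n)))"
proof -
  have X: "valid_space X" using X_valid by (simp add: valid_space_def)
  obtain g where g: "g \<in> borel_measurable borel" "in_space X g"
    and modulus: "conj_modulus2 X g = conj_modulus2 X f"
    and partial: "\<And>k. conj_partial_sum k g = conj_partial_sum k f"
    and trunc: "conj_trunc g = conj_trunc f"
    using borel_representative[OF X f_in] by metis
  have mean: "conj_mean A n g = conj_mean A n f" "conj_mean_converges A n g = conj_mean_converges A n f" for n
    by (simp_all add: fun_eq_iff conj_mean_def conj_mean_converges_def partial)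
  have "conj_fun g = conj_fun f" "conj_fun_exists g = conj_fun_exists f"
    by (simp_all add: fun_eq_iff conj_fun_def conj_fun_exists_def trunc)
  moreover have "rate X g A r n = rate X f A r n" for n by (simp add: rate_def modulus)
  ultimately have transfer: "conj_fun g = conj_fun f" "conj_fun_exists g = conj_fun_exists f"
    "\<And>n. rate X g A r n = rate X f A r n" by auto
  note eqs = transfer mean trunc modulus
  show ?thesis
  proof (intro conjI impI)
    assume "\<exists>K. \<forall>u\<in>{0..2 * pi}. (\<integral>\<^sup>+t\<in>{0..u}. ennreal (conj_modulus2 X f t / t) \<partial>lborel)
        \<le> ennreal (K * conj_modulus2 X f u)"
    then obtain K where K: "\<forall>u\<in>{0..2 * pi}.
        (\<integral>\<^sup>+t\<in>{0..u}. ennreal (conj_modulus2 X g t / t) \<partial>lborel) \<le> ennreal (K * conj_modulus2 X g u)"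
      unfolding eqs by blast
    have "ennreal (K * conj_modulus2 X g u) \<le> ennreal (max K 0 * conj_modulus2 X g u)" for u
      using modulus_nonneg[OF X g, of u] by (intro ennreal_leI mult_right_mono) auto
    with K have K': "\<forall>u\<in>{0..2 * pi}. (\<integral>\<^sup>+t\<in>{0..u}. ennreal (conj_modulus2 X g t / t) \<partial>lborel)
        \<le> ennreal (max K 0 * conj_modulus2 X g u)"
      by (blast intro: order_trans)
    note dev = conj_fun_deviation[where A = A, OF X g A_nonneg A_sums r_pos K' max.cobounded2, unfolded eqs]
    show "pointwise_in X (conj_fun_exists f)" by (rule dev(1))
    show "\<forall>n. pointwise_in X (conj_mean_converges A n f)" using dev(2) by blast
    show "\<exists>K. \<forall>n. in_space X (\<lambda>x. conj_mean A n f x - conj_fun f x) \<and>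
        norm_space X (\<lambda>x. conj_mean A n f x - conj_fun f x) \<le> K * rate X f A r n"
      using dev(3) by blast
  next
    assume "\<exists>K. \<forall>n. summable (\<lambda>k. (real k + 1) * A n k) \<and>
        (\<Sum>k. (real k + 1) * A n k) \<le> K * (real n + 1)"
    then obtain K where K: "\<And>n. summable (\<lambda>k. (real k + 1) * A n k)"
      "\<And>n. (\<Sum>k. (real k + 1) * A n k) \<le> K * (real n + 1)" by blast
    note dev = truncated_deviation[where A = A, OF X g A_nonneg A_sums r_pos K, unfolded eqs]
    show "\<forall>n. pointwise_in X (conj_mean_converges A n f)" using dev(1) by (cases X) auto
    show "\<exists>K. \<forall>n. in_space X (\<lambda>x. conj_mean A n f x - conj_trunc f x (pi / (real r * (real n + 1)))) \<and>
        norm_space X (\<lambda>x. conj_mean A n f x - conj_trunc f x (pi / (real r * (real n + 1))))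
          \<le> K * rate X f A r n"
      using dev(2) by blast
  qed
qed

end
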